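(* Let $G_1,G_2,\ldots,G_n,\ldots$ be a recursively constructible sequence of graphs and let $q\in\mathbb{Q}$. For each $n$ let $a_n$ be the number of dominating sets of $G_n$ of size at most $q|V(G_n)|$, and let $b_n$ be the number of dominating sets of $G_n$ of size at least $q|V(G_n)|$. Then the generating functions $\sum_{n\ge1}a_ny^n$ and $\sum_{n\ge1}b_ny^n$ are algebraic.
   Context: A set $S\subseteq V(G)$ is dominating in a finite simple graph $G$ if every vertex of $G$ is in $S$ or adjacent to a vertex of $S$. A formal power series is algebraic if it is algebraic over the field of rational functions $\mathbb{Q}(y)$. A sequence of graphs is recursively constructible (Noy and Ribó) if it is obtained from an initial graph by repeated application of a fixed sequence of elementary operations involving addition of vertices and edges and deletion of edges. Precisely: fix $k\ge 1$ and consider finite simple graphs in which each label from $\{1,\dots,k\}$ is carried by at most one vertex and each vertex carries at most one label (vertices may be unlabelled). The elementary operations are: adding a new isolated vertex carrying label $i$ (any vertex previously carrying $i$ becomes unlabelled); changing label $i$ to label $j$ (any other vertex previously carrying $j$ becomes unlabelled); removing label $i$; adding an edge between the vertices labelled $i$ and $j$, for $i\neq j$; deleting the edge between the vertices labelled $i$ and $j$. An operation has no effect if a label it refers to (other than that of a newly added vertex) is not present, or if the edge to be added/deleted is already present/absent. The sequence $G_1,G_2,\dots$ is recursively constructible if there are $k$, an initial labelled graph $\widehat G_1$ and a fixed finite composition $F$ of elementary operations such that $\widehat G_{n+1}=F(\widehat G_n)$ for all $n\ge 1$ and $G_n$ is the underlying unlabelled graph of $\widehat G_n$. *)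

theory Defs
  imports
    "HOL-Computational_Algebra.Computational_Algebra"
    "Graph_Theory.Graph_Theory"
begin

text \<open>
  A finite simple graph is a \<open>pair_graph\<close>: a finite, symmetric, loop-free set of arcs, so that
  an undirected edge is represented by its two arcs.
\<close>

definition dominating_set :: "'v pair_pre_digraph \<Rightarrow> 'v set \<Rightarrow> bool" where
  "dominating_set G S \<longleftrightarrow>
     S \<subseteq> pverts G \<and> (\<forall>v\<in>pverts G. v \<in> S \<or> (\<exists>u\<in>S. (u, v) \<in> parcs G))"

text \<open>
  \<open>label_of H i = Some v\<close> means that \<open>v\<close> is the vertex carrying the label \<open>i\<close>, and
  \<open>label_of H i = None\<close> that the label \<open>i\<close> is not present.
\<close>

record 'v labelled_graph =
  underlying :: "'v pair_pre_digraph"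
  label_of :: "nat \<Rightarrow> 'v option"

definition k_labelled_graph :: "nat \<Rightarrow> 'v labelled_graph \<Rightarrow> bool" where
  "k_labelled_graph k H \<longleftrightarrow>
     pair_graph (underlying H) \<and>
     dom (label_of H) \<subseteq> {1..k} \<and>
     ran (label_of H) \<subseteq> pverts (underlying H) \<and>
     inj_on (label_of H) (dom (label_of H))"

datatype elem_op =
    Add_Vertex nat
  | Change_Label nat nat
  | Remove_Label nat
  | Add_Edge nat nat
  | Delete_Edge nat nat

fun valid_op :: "nat \<Rightarrow> elem_op \<Rightarrow> bool" where
  "valid_op k (Add_Vertex i) \<longleftrightarrow> i \<in> {1..k}"
| "valid_op k (Change_Label i j) \<longleftrightarrow> i \<in> {1..k} \<and> j \<in> {1..k}"
| "valid_op k (Remove_Label i) \<longleftrightarrow> i \<in> {1..k}"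
| "valid_op k (Add_Edge i j) \<longleftrightarrow> i \<in> {1..k} \<and> j \<in> {1..k} \<and> i \<noteq> j"
| "valid_op k (Delete_Edge i j) \<longleftrightarrow> i \<in> {1..k} \<and> j \<in> {1..k}"

text \<open>
  The vertices are natural numbers only so that a fresh vertex can be chosen by a function; the
  choice does not matter, because the graphs of a sequence are taken up to isomorphism below.
  Changing the label \<open>i\<close> to \<open>j\<close> requires \<open>i\<close> to be present, but not \<open>j\<close>.
\<close>

fun apply_op :: "elem_op \<Rightarrow> nat labelled_graph \<Rightarrow> nat labelled_graph" where
  "apply_op (Add_Vertex i) H =
     (let G = underlying H; v = (LEAST v. v \<notin> pverts G)
      in \<lparr>underlying = G\<lparr>pverts := insert v (pverts G)\<rparr>,
          label_of = (label_of H)(i := Some v)\<rparr>)"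
| "apply_op (Change_Label i j) H =
     (case label_of H i of
        None \<Rightarrow> H
      | Some v \<Rightarrow> H\<lparr>label_of := (label_of H)(i := None, j := Some v)\<rparr>)"
| "apply_op (Remove_Label i) H = H\<lparr>label_of := (label_of H)(i := None)\<rparr>"
| "apply_op (Add_Edge i j) H =
     (case (label_of H i, label_of H j) of
        (Some u, Some v) \<Rightarrow>
          (let G = underlying H
           in H\<lparr>underlying := G\<lparr>parcs := parcs G \<union> {(u, v), (v, u)}\<rparr>\<rparr>)
      | _ \<Rightarrow> H)"
| "apply_op (Delete_Edge i j) H =
     (case (label_of H i, label_of H j) of
        (Some u, Some v) \<Rightarrow>
          (let G = underlying H
           in H\<lparr>underlying := G\<lparr>parcs := parcs G - {(u, v), (v, u)}\<rparr>\<rparr>)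
      | _ \<Rightarrow> H)"

text \<open>
  The sequences are indexed from \<open>1\<close>; nothing is required of \<open>G 0\<close>. The composition of elementary
  operations is given as a list, whose operations are applied from left to right.
\<close>

definition recursively_constructible :: "(nat \<Rightarrow> 'v pair_pre_digraph) \<Rightarrow> bool" where
  "recursively_constructible G \<longleftrightarrow>
     (\<exists>k\<ge>1. \<exists>ops H.
        (\<forall>f\<in>set ops. valid_op k f) \<and>
        k_labelled_graph k (H 1) \<and>
        (\<forall>n\<ge>1. H (Suc n) = fold apply_op ops (H n)) \<and>
        (\<forall>n\<ge>1. digraph_iso (with_proj (underlying (H n))) (with_proj (G n))))"

definition num_dominating_at_most :: "rat \<Rightarrow> 'v pair_pre_digraph \<Rightarrow> nat" where
  "num_dominating_at_most q G =
     card {S. dominating_set G S \<and> rat_of_nat (card S) \<le> q * rat_of_nat (card (pverts G))}"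

definition num_dominating_at_least :: "rat \<Rightarrow> 'v pair_pre_digraph \<Rightarrow> nat" where
  "num_dominating_at_least q G =
     card {S. dominating_set G S \<and> rat_of_nat (card S) \<ge> q * rat_of_nat (card (pverts G))}"

text \<open>
  The field of rational functions, as a subfield of the field of formal Laurent series.
\<close>

definition rational_functions :: "'a::field fls set" where
  "rational_functions =
     {fps_to_fls (fps_of_poly p) / fps_to_fls (fps_of_poly r) | p r. r \<noteq> 0}"

definition algebraic_over :: "'a::field set \<Rightarrow> 'a \<Rightarrow> bool" where
  "algebraic_over K x \<longleftrightarrow> (\<exists>P. P \<noteq> 0 \<and> (\<forall>i. coeff P i \<in> K) \<and> poly P x = 0)"

definition algebraic_fps :: "rat fps \<Rightarrow> bool" where
  "algebraic_fps f \<longleftrightarrow> algebraic_over rational_functions (fps_to_fls f)"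

definition gen_fun :: "(nat \<Rightarrow> nat) \<Rightarrow> rat fps" where
  "gen_fun a = Abs_fps (\<lambda>n. if n \<ge> 1 then of_nat (a n) else 0)"

end

theory Submission
  imports "HOL-Algebra.Algebraic_Closure_Type" Defs
begin

text \<open>
  Write \<open>y\<close> for the variable of the generating functions, and let \<open>x\<close> mark the size of a dominating
  set \<open>S\<close>.

  An unlabelled vertex never regains a label, so the edges at it are fixed for ever. What the later
  operations do to the domination status of a set \<open>S\<close> of vertices therefore depends only on a
  \<open>boundary_state\<close>, and there are finitely many of these. Hence the polynomials that count the sets \<open>S\<close>
  by size, one polynomial for each state, are transformed by a fixed square matrix over \<open>\<rat>[x]\<close> when
  the sequence of graphs makes one step (\<open>state_gf_apply_ops\<close>). By elimination the generating function
  of the dominating sets is a rational function of \<open>y\<close> over \<open>\<rat>[x]\<close>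
  (\<open>rational_fps_linear_system\<close>).

  The number of vertices grows linearly, so the condition \<open>card S \<le> q * card V\<close> on the \<open>n\<close>-th graph
  is, after clearing the denominator of \<open>q\<close>, a condition \<open>j < A * n + B\<close> on an exponent \<open>j\<close> of \<open>x\<close>. After
  the substitution of \<open>y / x ^ A\<close> for \<open>y\<close> and a division by \<open>x ^ B\<close>, the count becomes the value at
  \<open>x = 1\<close> of the part with negative exponents of \<open>x\<close> of a rational function \<open>R = F / D\<close>, where \<open>F\<close> and
  \<open>D\<close> are polynomials in \<open>x\<close> and \<open>y\<close> and \<open>D\<close> is a power of \<open>x\<close> modulo \<open>y\<close>.

  By Weierstrass preparation \<open>D = W * U\<close>, where \<open>W\<close> is monic in \<open>x\<close> and a power of \<open>x\<close> modulo \<open>y\<close>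
  (it collects the roots that vanish at \<open>y = 0\<close>), and \<open>U\<close> is a unit of \<open>\<rat>[x][[y]]\<close>. The
  negative part of \<open>R\<close> is \<open>\<alpha> / W\<close> for the polynomial \<open>\<alpha>\<close> of degree below that of \<open>W\<close> with
  \<open>F = \<alpha> * U + \<beta> * W\<close> (\<open>negative_part_decomposition\<close>). The roots of \<open>W\<close> are roots of \<open>D\<close>, hence
  algebraic over \<open>\<rat>(y)\<close>, and so are the coefficients of \<open>W\<close>, then those of \<open>U = D / W\<close>, and
  by a Bezout identity for \<open>U\<close> and \<open>W\<close> those of \<open>\<alpha>\<close>. The generating function is the value of
  \<open>\<alpha> / W\<close> at \<open>x = 1\<close> (\<open>algebraic_over_negative_part\<close>).

  The sets of size at least \<open>q * card V\<close> are all dominating sets except those of size less than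
  \<open>q * card V\<close>, and a strict inequality is a condition of the same kind.
\<close>

section \<open>Algebraic elements over a subfield\<close>

text \<open>
  A subfield is a set here, because the algebraic elements are formed inside one ambient field (the
  Laurent series, or the algebraic closure of that field) and polynomials are compared over both.
\<close>

locale field_subset =
  fixes K :: "'a::field set"
  assumes zero_mem: "0 \<in> K" and one_mem: "1 \<in> K"
    and add_mem: "x \<in> K \<Longrightarrow> y \<in> K \<Longrightarrow> x + y \<in> K"
    and minus_mem: "x \<in> K \<Longrightarrow> - x \<in> K"
    and mult_mem: "x \<in> K \<Longrightarrow> y \<in> K \<Longrightarrow> x * y \<in> K"
    and inverse_mem: "x \<in> K \<Longrightarrow> inverse x \<in> K"
begin

lemma diff_mem: "x \<in> K \<Longrightarrow> y \<in> K \<Longrightarrow> x - y \<in> K"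
  using add_mem[OF _ minus_mem] by fastforce

lemma divide_mem: "x \<in> K \<Longrightarrow> y \<in> K \<Longrightarrow> x / y \<in> K"
  by (simp add: divide_inverse mult_mem inverse_mem)

lemma sum_mem: "(\<And>i. i \<in> A \<Longrightarrow> f i \<in> K) \<Longrightarrow> sum f A \<in> K"
  by (induction A rule: infinite_finite_induct) (auto simp: zero_mem add_mem)

lemma power_mem: "x \<in> K \<Longrightarrow> x ^ n \<in> K"
  by (induction n) (auto simp: one_mem mult_mem)

text \<open>
  The carrier-based theory of field extensions shows that sums and products of algebraic elements are
  algebraic. This lemma and the next one translate to it from type classes.
\<close>

lemma subfield_ring_of_type: "subfield K (ring_of_type_algebra :: 'a ring)"
proof -
  interpret R: Ring.field "ring_of_type_algebra :: 'a ring"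
    by (rule field_from_type_algebra)
  have sub: "subring K (ring_of_type_algebra :: 'a ring)"
  proof (rule R.subringI)
    show "\<ominus>\<^bsub>ring_of_type_algebra\<^esub> h \<in> K" if "h \<in> K" for h :: 'a
    proof -
      have "\<ominus>\<^bsub>ring_of_type_algebra\<^esub> h = - h"
        by (rule R.add.inv_equality) (auto simp: ring_of_type_algebra_def)
      thus ?thesis using minus_mem[OF that] by simp
    qed
  qed (auto simp: ring_of_type_algebra_def one_mem mult_mem add_mem)
  show ?thesis
  proof (rule R.subfieldI'[OF sub])
    fix k assume k: "k \<in> K - {\<zero>\<^bsub>ring_of_type_algebra :: 'a ring\<^esub>}"
    have "inv\<^bsub>ring_of_type_algebra\<^esub> k = inverse k"
      using k by (intro R.comm_inv_char) (auto simp: ring_of_type_algebra_def)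
    thus "inv\<^bsub>ring_of_type_algebra\<^esub> k \<in> K"
      using k by (auto simp: inverse_mem)
  qed
qed

lemma algebraic_over_iff_ring:
  "algebraic_over K x \<longleftrightarrow> (ring.algebraic (ring_of_type_algebra :: 'a ring) over K) x"
proof -
  interpret R: Ring.field "ring_of_type_algebra :: 'a ring"
    by (rule field_from_type_algebra)
  have pow: "x [^]\<^bsub>ring_of_type_algebra\<^esub> n = x ^ n" for x :: 'a and n :: nat
    by (induction n) (auto simp: ring_of_type_algebra_def)
  have eval: "R.eval p x = poly (Poly (rev p)) x" for p and x :: 'a
    by (induction p)
      (auto simp: Poly_append poly_monom pow, auto simp: ring_of_type_algebra_def)
  have sub: "subring K (ring_of_type_algebra :: 'a ring)"
    using subfieldE(1)[OF subfield_ring_of_type] .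
  show ?thesis
  proof
    assume "algebraic_over K x"
    then obtain P where P: "P \<noteq> 0" "\<forall>i. coeff P i \<in> K" "poly P x = 0"
      unfolding algebraic_over_def by blast
    show "(R.algebraic over K) x"
    proof (rule R.algebraicI)
      show "rev (coeffs P) \<in> carrier (K [X]\<^bsub>ring_of_type_algebra\<^esub>)"
        using P(1,2) by (auto simp: univ_poly_def polynomial_def hd_rev
          last_coeffs_eq_coeff_degree coeffs_def)
           (auto simp: ring_of_type_algebra_def)
      show "R.eval (rev (coeffs P)) x = \<zero>\<^bsub>ring_of_type_algebra\<^esub>"
        using P(3) by (simp add: eval) (simp add: ring_of_type_algebra_def)
    qed (use P in auto)
  next
    assume "(R.algebraic over K) x"
    then obtain p where p: "p \<in> carrier (K [X]\<^bsub>ring_of_type_algebra\<^esub>)" "p \<noteq> []"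
      "R.eval p x = \<zero>\<^bsub>ring_of_type_algebra\<^esub>"
      using R.algebraicE[OF sub, of x] by (auto simp: ring_of_type_algebra_def)
    have set: "set p \<subseteq> K" and hd: "hd p \<noteq> 0"
      using p by (auto simp: univ_poly_def polynomial_def) (auto simp: ring_of_type_algebra_def)
    have "coeff (Poly (rev p)) (length p - 1) = hd p"
      using p(2) by (simp add: nth_default_def rev_nth hd_conv_nth)
    hence "Poly (rev p) \<noteq> 0" using hd by force
    moreover have "coeff (Poly (rev p)) i \<in> K" for i
      using set zero_mem by (auto simp: nth_default_def rev_nth)
    moreover have "poly (Poly (rev p)) x = 0"
      using p(3) by (simp add: eval) (simp add: ring_of_type_algebra_def)
    ultimately show "algebraic_over K x"
      unfolding algebraic_over_def by blast
  qed
qed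

lemma field_subset_algebraic: "field_subset {x. algebraic_over K x}"
proof -
  interpret R: Ring.field "ring_of_type_algebra :: 'a ring"
    by (rule field_from_type_algebra)
  let ?A = "{x. algebraic_over K x}"
  have A: "subfield ?A (ring_of_type_algebra :: 'a ring)"
    using R.subfield_of_algebraics[OF subfield_ring_of_type]
    by (simp add: algebraic_over_iff_ring) (simp add: ring_of_type_algebra_def)
  note s = subfieldE(1)[OF A]
  have inv: "\<ominus>\<^bsub>ring_of_type_algebra\<^esub> h = - h" for h :: 'a
    by (rule R.add.inv_equality) (auto simp: ring_of_type_algebra_def)
  show ?thesis
  proof
    show "0 \<in> ?A" "1 \<in> ?A"
      using subringE(2,3)[OF s] by (auto simp: ring_of_type_algebra_def)
    show "- x \<in> ?A" if "x \<in> ?A" for x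
      using subringE(5)[OF s that] by (simp add: inv)
    show "x * y \<in> ?A" "x + y \<in> ?A" if "x \<in> ?A" "y \<in> ?A" for x y
      using subringE(6,7)[OF s that] by (auto simp: ring_of_type_algebra_def)
    show "inverse x \<in> ?A" if x: "x \<in> ?A" for x
    proof (cases "x = 0")
      case False
      have "inv\<^bsub>ring_of_type_algebra\<^esub> x = inverse x"
        using False by (intro R.comm_inv_char) (auto simp: ring_of_type_algebra_def)
      moreover have "inv\<^bsub>ring_of_type_algebra\<^esub> x \<in> ?A"
        using R.subfield_m_inv(1)[OF A] x False by (auto simp: ring_of_type_algebra_def)
      ultimately show ?thesis by simp
    qed (use x in auto)
  qed
qed

lemma algebraic_over_mem: "x \<in> K \<Longrightarrow> algebraic_over K x"
  unfolding algebraic_over_def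
  by (rule exI[of _ "[:- x, 1:]"])
     (auto simp: coeff_pCons zero_mem one_mem minus_mem split: nat.splits)

end

definition polys_over :: "'a::zero set \<Rightarrow> 'a poly set" where
  "polys_over K = {p. \<forall>i. coeff p i \<in> K}"

context field_subset
begin

lemma polys_over_mult: "p \<in> polys_over K \<Longrightarrow> r \<in> polys_over K \<Longrightarrow> p * r \<in> polys_over K"
  by (auto simp: polys_over_def coeff_mult intro!: sum_mem mult_mem)

lemma polys_over_diff: "p \<in> polys_over K \<Longrightarrow> r \<in> polys_over K \<Longrightarrow> p - r \<in> polys_over K"
  by (auto simp: polys_over_def intro!: diff_mem)

lemma polys_over_add: "p \<in> polys_over K \<Longrightarrow> r \<in> polys_over K \<Longrightarrow> p + r \<in> polys_over K"
  by (auto simp: polys_over_def intro!: add_mem)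

lemma polys_over_monom: "c \<in> K \<Longrightarrow> monom c n \<in> polys_over K"
  by (auto simp: polys_over_def zero_mem)

lemma polys_over_pCons: "c \<in> K \<Longrightarrow> p \<in> polys_over K \<Longrightarrow> pCons c p \<in> polys_over K"
  by (auto simp: polys_over_def coeff_pCons split: nat.splits)

lemma polys_over_0: "0 \<in> polys_over K"
  by (auto simp: polys_over_def zero_mem)

lemma polys_over_1: "1 \<in> polys_over K"
  using polys_over_pCons[OF one_mem polys_over_0] by (simp add: one_pCons)

lemma poly_mem: "p \<in> polys_over K \<Longrightarrow> x \<in> K \<Longrightarrow> poly p x \<in> K"
  by (auto simp: poly_altdef polys_over_def intro!: sum_mem mult_mem power_mem)

text \<open>
  Long division by \<open>r\<close> only divides by the leading coefficient of \<open>r\<close>, so it never leaves the subfield.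
\<close>

lemma polys_over_div_mod:
  assumes "p \<in> polys_over K" "r \<in> polys_over K" "r \<noteq> 0"
  shows "p div r \<in> polys_over K \<and> p mod r \<in> polys_over K"
  using assms(1)
proof (induction "degree p" arbitrary: p rule: less_induct)
  case less
  show ?case
  proof (cases "degree p < degree r \<or> p = 0")
    case True
    thus ?thesis
      using less.prems by (auto simp: div_poly_less mod_poly_less polys_over_0)
  next
    case False
    define m where "m = monom (lead_coeff p / lead_coeff r) (degree p - degree r)"
    have m: "m \<in> polys_over K"
      using less.prems assms(2) unfolding m_def
      by (intro polys_over_monom divide_mem) (auto simp: polys_over_def)
    define p' where "p' = p - m * r"
    have p': "p' \<in> polys_over K"
      unfolding p'_def using m less.prems assms by (intro polys_over_diff polys_over_mult)
    have p: "p = p' + m * r" by (simp add: p'_def)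
    have step: "p div r = m + p' div r" "p mod r = p' mod r"
      using assms(3) by (subst p, simp)+
    have "lead_coeff p \<noteq> 0" "lead_coeff r \<noteq> 0" using False assms(3) by auto
    hence dm: "degree (m * r) = degree p" 
      using False by (auto simp: m_def degree_mult_eq degree_monom_eq monom_eq_0_iff)
    have "coeff (m * r) (degree p) = lead_coeff p"
    proof -
      have "coeff (m * r) (degree p) = lead_coeff (m * r)" by (simp add: dm)
      also have "\<dots> = lead_coeff m * lead_coeff r" by (rule lead_coeff_mult)
      also have "lead_coeff m = lead_coeff p / lead_coeff r"
        unfolding m_def by (rule lead_coeff_monom)
      also have "\<dots> * lead_coeff r = lead_coeff p" using assms(3) by simp
      finally show ?thesis .
    qed
    hence "coeff p' (degree p) = 0" by (simp add: p'_def)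
    moreover have "degree p' \<le> degree p"
      unfolding p'_def using dm by (intro degree_diff_le) auto
    ultimately have "p' = 0 \<or> degree p' < degree p"
      by (metis le_neq_implies_less leading_coeff_0_iff)
    thus ?thesis
    proof
      assume "p' = 0"
      thus ?thesis using m by (simp add: step polys_over_0)
    next
      assume "degree p' < degree p"
      from less.hyps[OF this p'] show ?thesis
        using m by (simp add: step polys_over_add)
    qed
  qed
qed

text \<open>
  The coprimality is that over the whole field, but the Euclidean algorithm stays in the subfield, so
  the cofactors can be taken there.
\<close>

lemma bezout_polys_over:
  assumes "p \<in> polys_over K" "r \<in> polys_over K" "coprime p r"
  shows "\<exists>s\<in>polys_over K. \<exists>t\<in>polys_over K. s * p + t * r = 1"
  using assms
proof (induction "if r = 0 then 0 else Suc (degree r)" arbitrary: p r rule: less_induct)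
  case less
  show ?case
  proof (cases "r = 0")
    case True
    hence "is_unit p" using less.prems by simp
    then obtain c where c: "p = [:c:]" "c dvd 1"
      unfolding is_unit_poly_iff by blast
    have "c \<noteq> 0" using c(2) by auto
    have "inverse c \<in> K"
      using less.prems(1) c(1) by (intro inverse_mem) (auto simp: polys_over_def dest: spec[of _ 0])
    thus ?thesis
      using c(1) True \<open>c \<noteq> 0\<close>
      by (intro bexI[of _ "[:inverse c:]"] bexI[of _ 0]) (auto simp: polys_over_0 polys_over_pCons one_pCons)
  next
    case False
    note dm = polys_over_div_mod[OF less.prems(1,2) False]
    have "(if p mod r = 0 then 0 else Suc (degree (p mod r))) < (if r = 0 then 0 else Suc (degree r))"
      using False degree_mod_less[OF False, of p] by auto
    moreover have "coprime r (p mod r)"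
      using less.prems(3) False by (simp add: coprime_commute coprime_mod_left_iff)
    ultimately obtain s t where st: "s \<in> polys_over K" "t \<in> polys_over K"
      "s * r + t * (p mod r) = 1"
      using less.hyps[of "p mod r" r] less.prems(2) dm by auto
    have "t * p + (s - t * (p div r)) * r = s * r + t * (p - (p div r) * r)"
      by (simp add: algebra_simps)
    also have "\<dots> = 1"
      using st(3) by (simp add: minus_div_mult_eq_mod)
    finally show ?thesis
      using st dm by (intro bexI[of _ t] bexI[of _ "s - t * (p div r)"])
        (auto intro: polys_over_diff polys_over_mult)
  qed
qed

lemma field_subset_to_ac: "field_subset (to_ac ` K)"
proof
  show "0 \<in> to_ac ` K" using zero_mem by (metis imageI to_ac_0)
  show "1 \<in> to_ac ` K" using one_mem by (metis imageI to_ac_1)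
qed (auto simp: zero_mem add_mem minus_mem mult_mem inverse_mem
       simp flip: to_ac_add to_ac_minus to_ac_mult to_ac_inverse intro!: imageI)

text \<open>
  Algebraicity that was found in the algebraic closure descends, since the witness polynomial already
  has its coefficients in the image of \<open>K\<close>.
\<close>

lemma algebraic_over_to_acD:
  assumes "algebraic_over (to_ac ` K) (to_ac x)"
  shows "algebraic_over K x"
proof -
  from assms obtain P where P: "P \<noteq> 0" "\<forall>i. coeff P i \<in> to_ac ` K" "poly P (to_ac x) = 0"
    unfolding algebraic_over_def by blast
  define p where "p = map_poly of_ac P"
  have coeff_p: "to_ac (coeff p i) = coeff P i" "coeff p i \<in> K" for i
  proof -
    obtain k where "k \<in> K" "coeff P i = to_ac k" using P(2) by blast
    thus "to_ac (coeff p i) = coeff P i" "coeff p i \<in> K"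
      by (auto simp: p_def coeff_map_poly)
  qed
  have P_eq: "P = map_poly to_ac p"
    by (intro poly_eqI) (simp add: coeff_map_poly coeff_p)
  have "degree P = degree p"
    by (simp add: P_eq degree_map_poly)
  hence "to_ac (poly p x) = poly P (to_ac x)"
    by (simp add: poly_altdef to_ac_sum coeff_p)
  hence "poly p x = 0" using P(3) by simp
  moreover have "p \<noteq> 0" using P(1) P_eq by auto
  ultimately show ?thesis
    unfolding algebraic_over_def using coeff_p(2) by blast
qed

text \<open>
  Over an algebraic closure of the big field, \<open>W\<close> is the product of the \<open>x - z\<close> over its roots \<open>z\<close>.
  These are roots of \<open>W * U\<close>, which has coefficients in \<open>K\<close>, so they are algebraic over \<open>K\<close>, and the
  coefficients of \<open>W\<close> are polynomial expressions in them.
\<close>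

lemma monic_factor_coeffs_algebraic:
  assumes "W * U \<in> polys_over K" "W * U \<noteq> 0" "lead_coeff W = 1"
  shows "W \<in> polys_over {x. algebraic_over K x}"
proof -
  interpret K': field_subset "to_ac ` K" by (rule field_subset_to_ac)
  let ?A = "{x. algebraic_over (to_ac ` K) x}"
  interpret A: field_subset ?A by (rule K'.field_subset_algebraic)
  define W' where "W' = map_poly to_ac W"
  define D' where "D' = map_poly to_ac (W * U)"
  have D': "D' = W' * map_poly to_ac U"
    by (intro poly_eqI) (simp add: D'_def W'_def coeff_map_poly coeff_mult to_ac_sum)
  have D'_mem: "coeff D' i \<in> to_ac ` K" for i
    using assms(1) by (auto simp: D'_def coeff_map_poly polys_over_def)
  have "D' \<noteq> 0"
    using assms(2) by (metis D'_def coeff_0 coeff_map_poly poly_eqI to_ac_0 to_ac_eq_0_iff)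
  have lc: "lead_coeff W' = 1"
    using assms(3) by (simp add: W'_def coeff_map_poly degree_map_poly)
  hence "W' \<noteq> 0" by auto
  then obtain Z where Z: "W' = (\<Prod>x\<in>#Z. [:- x, 1:])"
    using alg_closed_imp_factorization[of W'] lc by auto
  have roots: "x \<in> ?A" if "x \<in># Z" for x
  proof -
    have "[:- x, 1:] dvd W'" unfolding Z using that by (intro dvd_prod_mset) auto
    hence "poly D' x = 0" unfolding D' by (simp add: poly_eq_0_iff_dvd)
    thus ?thesis using \<open>D' \<noteq> 0\<close> D'_mem unfolding algebraic_over_def by blast
  qed
  have "W' \<in> polys_over ?A"
    unfolding Z using roots
  proof (induction Z)
    case (add x Z)
    thus ?case
      by (auto intro!: A.polys_over_mult A.polys_over_pCons A.polys_over_0 A.minus_mem A.one_mem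
               simp del: mult_pCons_left)
  qed (auto intro: A.polys_over_1)
  thus ?thesis
    using algebraic_over_to_acD by (auto simp: polys_over_def W'_def coeff_map_poly)
qed

end

section \<open>Weierstrass division for series with polynomial coefficients\<close>

text \<open>
  Every coefficient of the series in \<open>y\<close> is a polynomial in \<open>x\<close> of degree less than \<open>d\<close>. Stating this
  by coefficients lets the zero polynomial have degree less than \<open>0\<close>.
\<close>

definition x_deg_less :: "nat \<Rightarrow> 'a::zero poly fps \<Rightarrow> bool" where
  "x_deg_less d f \<longleftrightarrow> (\<forall>n j. d \<le> j \<longrightarrow> coeff (f $ n) j = 0)"

lemma poly_cutoff_plus_shift:
  fixes p :: "'a::comm_ring_1 poly"
  shows "p = poly_cutoff d p + monom 1 d * poly_shift d p"
  by (rule poly_eqI) (auto simp: coeff_poly_cutoff coeff_poly_shift coeff_monom_mult)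

lemma coeff_mult_eq_0:
  fixes p r :: "'a::comm_ring_1 poly"
  assumes "\<And>j. a < j \<Longrightarrow> coeff p j = 0" "\<And>j. b \<le> j \<Longrightarrow> coeff r j = 0" "a + b \<le> k"
  shows "coeff (p * r) k = 0"
  unfolding coeff_mult
proof (rule sum.neutral, rule ballI)
  fix i assume "i \<in> {..k}"
  show "coeff p i * coeff r (k - i) = 0"
  proof (cases "a < i")
    case False
    hence "b \<le> k - i" using assms(3) by linarith
    thus ?thesis by (simp add: assms(2))
  qed (simp add: assms(1))
qed

text \<open>
  The coefficients of the quotient \<open>q\<close> of \<open>f\<close> by \<open>D\<close> when \<open>D\<close> is \<open>x ^ d\<close> modulo \<open>y\<close>. The coefficient of
  \<open>y ^ n\<close> in \<open>q * D\<close> is \<open>q\<^sub>n * x ^ d\<close> plus terms with earlier coefficients of \<open>q\<close>, so \<open>q\<^sub>n\<close> has to be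
  the quotient by \<open>x ^ d\<close> of what these terms leave of the coefficient of \<open>f\<close>.
\<close>

fun weierstrass_quotient :: "nat \<Rightarrow> 'a::comm_ring_1 poly fps \<Rightarrow> 'a poly fps \<Rightarrow> nat \<Rightarrow> 'a poly" where
  "weierstrass_quotient d D f n =
     poly_shift d (f $ n - (\<Sum>i<n. weierstrass_quotient d D f i * D $ (n - i)))"

declare weierstrass_quotient.simps [simp del]

lemma weierstrass_division:
  fixes D f :: "'a::comm_ring_1 poly fps"
  assumes "D $ 0 = monom 1 d"
  shows "\<exists>q r. f = q * D + r \<and> x_deg_less d r"
proof -
  define q where "q = Abs_fps (weierstrass_quotient d D f)"
  define g where "g = (\<lambda>n. f $ n - (\<Sum>i<n. q $ i * D $ (n - i)))"
  define r where "r = Abs_fps (\<lambda>n. poly_cutoff d (g n))"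
  have q: "q $ n = poly_shift d (g n)" for n
    unfolding q_def g_def by simp (subst weierstrass_quotient.simps, simp)
  have "f $ n = (q * D + r) $ n" for n
  proof -
    have "(q * D) $ n = (\<Sum>i<n. q $ i * D $ (n - i)) + q $ n * D $ 0"
      unfolding fps_mult_nth atLeast0AtMost lessThan_Suc_atMost[symmetric] by simp
    moreover have "q $ n * D $ 0 + r $ n = g n"
      using poly_cutoff_plus_shift[of "g n" d]
      by (simp add: q r_def assms algebra_simps)
    ultimately show ?thesis by (simp add: g_def algebra_simps)
  qed
  hence "f = q * D + r" by (simp add: fps_eq_iff)
  moreover have "x_deg_less d r"
    by (auto simp: x_deg_less_def r_def coeff_poly_cutoff)
  ultimately show ?thesis by blast
qed

lemma x_deg_less_mono: "x_deg_less a f \<Longrightarrow> a \<le> b \<Longrightarrow> x_deg_less b f"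
  by (auto simp: x_deg_less_def)

lemma x_deg_less_mult:
  fixes f g :: "'a::comm_ring_1 poly fps"
  shows "x_deg_less a f \<Longrightarrow> x_deg_less b g \<Longrightarrow> x_deg_less (a + b) (f * g)"
  unfolding x_deg_less_def fps_mult_nth coeff_sum
  by (intro allI impI sum.neutral ballI) (rule coeff_mult_eq_0[of a _ b], auto)

lemma x_deg_less_diff:
  fixes f g :: "'a::comm_ring_1 poly fps"
  shows "x_deg_less a f \<Longrightarrow> x_deg_less b g \<Longrightarrow> x_deg_less (max a b) (f - g)"
  by (auto simp: x_deg_less_def)

lemma x_deg_less_1: "x_deg_less 1 (1 :: 'a::comm_ring_1 poly fps)"
  by (auto simp: x_deg_less_def)

lemma x_deg_less_finite:
  assumes "\<And>n. s < n \<Longrightarrow> f $ n = 0"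
  shows "\<exists>e. x_deg_less e f"
proof
  show "x_deg_less (Suc (Max ((\<lambda>n. degree (f $ n)) ` {..s}))) f"
    unfolding x_deg_less_def
  proof (intro allI impI)
    fix n j assume j: "Suc (Max ((\<lambda>n. degree (f $ n)) ` {..s})) \<le> j"
    show "coeff (f $ n) j = 0"
    proof (cases "s < n")
      case False
      hence "degree (f $ n) \<le> Max ((\<lambda>n. degree (f $ n)) ` {..s})" by (intro Max_ge) auto
      thus ?thesis using j by (intro coeff_eq_0) auto
    qed (simp add: assms)
  qed
qed

text \<open>
  As a polynomial in \<open>x\<close> over the power series in \<open>y\<close>, such a \<open>W\<close> is monic of degree \<open>d\<close>; moreover its
  lower coefficients vanish at \<open>y = 0\<close>. It is a Weierstrass polynomial.
\<close>

definition x_monic :: "nat \<Rightarrow> 'a::comm_ring_1 poly fps \<Rightarrow> bool" where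
  "x_monic d W \<longleftrightarrow> W $ 0 = monom 1 d \<and> (\<forall>n>0. \<forall>j\<ge>d. coeff (W $ n) j = 0)"

lemma x_monic_coeff: "x_monic d W \<Longrightarrow> d < j \<Longrightarrow> coeff (W $ n) j = 0"
  unfolding x_monic_def by (cases n) auto

lemma x_deg_less_x_monic: "x_monic d W \<Longrightarrow> x_deg_less (Suc d) W"
  by (auto simp: x_deg_less_def x_monic_coeff)

text \<open>
  A factor of a polynomial whose other factor is monic in \<open>x\<close> has the degree one expects. The product
  is only known as a series in \<open>y\<close>, so the bound is obtained one power of \<open>y\<close> at a time: the
  coefficient of \<open>y ^ n\<close> in \<open>W * f\<close> is \<open>x ^ d * f\<^sub>n\<close> plus terms of degree less than \<open>d + e\<close>.
\<close>

lemma x_deg_less_cofactor: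
  fixes W f :: "'a::comm_ring_1 poly fps"
  assumes W: "x_monic d W" and Wf: "x_deg_less (d + e) (W * f)"
  shows "x_deg_less e f"
proof -
  have "coeff (f $ n) j = 0" if "e \<le> j" for n j
    using that
  proof (induction n arbitrary: j rule: less_induct)
    case (less n)
    have "0 = coeff ((W * f) $ n) (d + j)"
      using Wf less.prems by (simp add: x_deg_less_def)
    also have "\<dots> = coeff (W $ 0 * f $ n) (d + j)
        + (\<Sum>i\<in>{0<..n}. coeff (W $ i * f $ (n - i)) (d + j))"
      unfolding fps_mult_nth coeff_sum
      by (subst sum.head) auto
    also have "(\<Sum>i\<in>{0<..n}. coeff (W $ i * f $ (n - i)) (d + j)) = 0"
    proof (rule sum.neutral, rule ballI)
      fix i assume i: "i \<in> {0<..n}"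
      show "coeff (W $ i * f $ (n - i)) (d + j) = 0"
      proof (rule coeff_mult_eq_0[of d _ e])
        show "coeff (f $ (n - i)) k = 0" if "e \<le> k" for k
          using i that by (intro less.IH) auto
      qed (use less.prems x_monic_coeff[OF W] in auto)
    qed
    finally show ?case using W by (simp add: x_monic_def coeff_monom_mult)
  qed
  thus ?thesis by (simp add: x_deg_less_def)
qed

text \<open>
  A series in \<open>y\<close> of bounded degree in \<open>x\<close>, read as a polynomial in \<open>x\<close> over the field of Laurent series
  in \<open>y\<close>; over a field there are division and greatest common divisors. For unbounded degree the
  value has no meaning.
\<close>

definition swap_vars :: "'a::field poly fps \<Rightarrow> 'a fls poly" where
  "swap_vars f = Abs_poly (\<lambda>j. fps_to_fls (Abs_fps (\<lambda>n. coeff (f $ n) j)))"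

lemma coeff_swap_vars:
  assumes "x_deg_less e f"
  shows "coeff (swap_vars f) j = fps_to_fls (Abs_fps (\<lambda>n. coeff (f $ n) j))"
proof -
  have "(\<lambda>j. fps_to_fls (Abs_fps (\<lambda>n. coeff (f $ n) j))) j = 0" if "j > e" for j
    using assms that by (simp add: x_deg_less_def fps_zero_def[symmetric])
  thus ?thesis unfolding swap_vars_def
    by (subst coeff_Abs_poly) auto
qed

lemma fps_to_fls_sum: "fps_to_fls (sum f A) = (\<Sum>i\<in>A. fps_to_fls (f i))"
  by (induction A rule: infinite_finite_induct) (auto simp: fps_to_fls_plus)

lemma swap_vars_mult:
  assumes "x_deg_less a f" "x_deg_less b g"
  shows "swap_vars (f * g) = swap_vars f * swap_vars g"
proof (rule poly_eqI)
  fix k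
  have "Abs_fps (\<lambda>n. coeff ((f * g) $ n) k) =
    (\<Sum>j\<le>k. Abs_fps (\<lambda>n. coeff (f $ n) j) * Abs_fps (\<lambda>n. coeff (g $ n) (k - j)))"
    by (rule fps_ext, simp add: fps_mult_nth fps_sum_nth coeff_sum coeff_mult)
       (rule sum.swap)
  thus "coeff (swap_vars (f * g)) k = coeff (swap_vars f * swap_vars g) k"
    by (simp add: coeff_mult coeff_swap_vars[OF assms(1)] coeff_swap_vars[OF assms(2)]
      coeff_swap_vars[OF x_deg_less_mult[OF assms]] fps_to_fls_sum fls_times_fps_to_fls)
qed

lemma swap_vars_diff:
  assumes "x_deg_less a f" "x_deg_less b g"
  shows "swap_vars (f - g) = swap_vars f - swap_vars g"
proof (rule poly_eqI)
  fix k
  have "Abs_fps (\<lambda>n. coeff ((f - g) $ n) k) =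
    Abs_fps (\<lambda>n. coeff (f $ n) k) - Abs_fps (\<lambda>n. coeff (g $ n) k)"
    by (rule fps_ext) simp
  thus "coeff (swap_vars (f - g)) k = coeff (swap_vars f - swap_vars g) k"
    by (simp add: coeff_swap_vars[OF assms(1)] coeff_swap_vars[OF assms(2)]
      coeff_swap_vars[OF x_deg_less_diff[OF assms]] fps_to_fls_minus)
qed

lemma swap_vars_1: "swap_vars 1 = 1"
proof (rule poly_eqI)
  fix k
  have "Abs_fps (\<lambda>n. coeff ((1 :: 'a poly fps) $ n) k) = (if k = 0 then 1 else 0)"
    by (rule fps_ext) auto
  thus "coeff (swap_vars 1) k = coeff (1 :: 'a fls poly) k"
    by (simp add: coeff_swap_vars[OF x_deg_less_1])
qed

definition eval_at_1 :: "'a::comm_ring_1 poly fps \<Rightarrow> 'a fps" where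
  "eval_at_1 f = Abs_fps (\<lambda>n. poly (f $ n) 1)"

lemma eval_at_1_mult: "eval_at_1 (f * g) = eval_at_1 f * eval_at_1 g"
  by (rule fps_ext) (simp add: eval_at_1_def fps_mult_nth poly_sum)

lemma poly_1_eq_sum_coeffs:
  fixes p :: "'a::comm_ring_1 poly"
  assumes "\<And>j. e \<le> j \<Longrightarrow> coeff p j = 0"
  shows "poly p 1 = (\<Sum>j<e. coeff p j)"
proof (cases "p = 0")
  case False
  hence "degree p < e" using assms[of "degree p"] by force
  hence "(\<Sum>j<e. coeff p j) = (\<Sum>j\<le>degree p. coeff p j)"
    by (intro sum.mono_neutral_right) (auto simp: coeff_eq_0)
  thus ?thesis by (simp add: poly_altdef)
qed simp

lemma poly_swap_vars_1:
  assumes "x_deg_less e f"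
  shows "poly (swap_vars f) 1 = fps_to_fls (eval_at_1 f)"
proof -
  have "poly (swap_vars f) 1 = (\<Sum>j<e. fps_to_fls (Abs_fps (\<lambda>n. coeff (f $ n) j)))"
  proof (subst poly_1_eq_sum_coeffs)
    show "coeff (swap_vars f) j = 0" if "e \<le> j" for j
      using assms that by (simp add: coeff_swap_vars[OF assms] x_deg_less_def fps_zero_def[symmetric])
  qed (simp add: coeff_swap_vars[OF assms])
  also have "\<dots> = fps_to_fls (\<Sum>j<e. Abs_fps (\<lambda>n. coeff (f $ n) j))"
    by (simp add: fps_to_fls_sum)
  also have "(\<Sum>j<e. Abs_fps (\<lambda>n. coeff (f $ n) j)) = eval_at_1 f"
    using assms by (intro fps_ext)
      (auto simp: eval_at_1_def fps_sum_nth x_deg_less_def intro!: poly_1_eq_sum_coeffs[symmetric])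
  finally show ?thesis .
qed

section \<open>Negative parts of bivariate rational functions\<close>

text \<open>
  The substitution of \<open>x ^ A * y\<close> for \<open>y\<close>. It is the inverse of the substitution of \<open>y / x ^ A\<close> and, unlike
  that one, needs no negative exponents of \<open>x\<close>. Identities between series with Laurent polynomials in
  \<open>x\<close> as coefficients are therefore stated below after tilting both sides.
\<close>

definition tilt :: "nat \<Rightarrow> 'a::comm_ring_1 poly fps \<Rightarrow> 'a poly fps" where
  "tilt A f = Abs_fps (\<lambda>n. monom 1 (A * n) * f $ n)"

lemma tilt_mult: "tilt A (f * g) = tilt A f * tilt A g"
proof (rule fps_ext)
  fix n
  have "monom 1 (A * n) * (f $ i * g $ (n - i)) =
      (monom 1 (A * i) * f $ i) * (monom 1 (A * (n - i)) * g $ (n - i))" if "i \<le> n" for i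
  proof -
    have "monom (1::'a) (A * n) = monom 1 (A * i) * monom 1 (A * (n - i))"
      using that by (simp add: mult_monom flip: distrib_left)
    thus ?thesis by (simp add: ac_simps)
  qed
  thus "tilt A (f * g) $ n = (tilt A f * tilt A g) $ n"
    by (auto simp add: tilt_def fps_mult_nth sum_distrib_left intro!: sum.cong)
qed

lemma tilt_diff: "tilt A (f - g) = tilt A f - tilt A g"
  by (rule fps_ext) (simp add: tilt_def algebra_simps)

lemma eval_at_1_tilt: "eval_at_1 (tilt A f) = eval_at_1 f"
  by (rule fps_ext) (simp add: eval_at_1_def tilt_def poly_monom)

lemma field_subset_rational_functions: "field_subset (rational_functions :: 'a::field fls set)"
proof -
  define e where "e = (\<lambda>p :: 'a poly. fps_to_fls (fps_of_poly p))"
  have e: "e (p + r) = e p + e r" "e (p * r) = e p * e r" "e (- p) = - e p" "e 0 = 0" "e 1 = 1"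
    "e p = 0 \<longleftrightarrow> p = 0" for p r
    by (simp_all add: e_def fps_of_poly_add fps_of_poly_mult fps_of_poly_uminus
      fls_times_fps_to_fls)
  have mem: "x \<in> rational_functions \<longleftrightarrow> (\<exists>p r. r \<noteq> 0 \<and> x = e p / e r)" for x
    by (auto simp: rational_functions_def e_def)
  show ?thesis
  proof
    show "(0 :: 'a fls) \<in> rational_functions"
      unfolding mem by (rule exI[of _ 0], rule exI[of _ 1]) (simp add: e)
    show "(1 :: 'a fls) \<in> rational_functions"
      unfolding mem by (rule exI[of _ 1], rule exI[of _ 1]) (simp add: e)
    fix x :: "'a fls" assume "x \<in> rational_functions"
    then obtain p r where x: "r \<noteq> 0" "x = e p / e r" unfolding mem by blast
    show "- x \<in> rational_functions"
      unfolding mem by (rule exI[of _ "- p"], rule exI[of _ r]) (use x in \<open>simp add: e\<close>)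
    show "inverse x \<in> rational_functions"
    proof (cases "p = 0")
      case True
      hence "inverse x = x" using x by (simp add: e)
      thus ?thesis using \<open>x \<in> rational_functions\<close> by simp
    next
      case False
      show ?thesis unfolding mem
        by (rule exI[of _ r], rule exI[of _ p]) (use x False in \<open>simp add: e\<close>)
    qed
    fix y :: "'a fls" assume "y \<in> rational_functions"
    then obtain p' r' where y: "r' \<noteq> 0" "y = e p' / e r'" unfolding mem by blast
    show "x + y \<in> rational_functions"
      unfolding mem by (rule exI[of _ "p * r' + p' * r"], rule exI[of _ "r * r'"])
        (use x y in \<open>simp add: e add_frac_eq\<close>)
    show "x * y \<in> rational_functions"
      unfolding mem by (rule exI[of _ "p * p'"], rule exI[of _ "r * r'"])
        (use x y in \<open>simp add: e\<close>)
  qed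
qed

lemma fps_of_poly_in_rational_functions: "fps_to_fls (fps_of_poly p) \<in> rational_functions"
  unfolding rational_functions_def by (rule CollectI, rule exI[of _ p], rule exI[of _ 1]) simp

text \<open>
  Weierstrass preparation: dividing \<open>x ^ d\<close> by \<open>D\<close> gives \<open>x ^ d = q * D + r\<close>, and \<open>W = x ^ d - r\<close> is the
  multiple \<open>q * D\<close>. At \<open>y = 0\<close> the degrees force \<open>q = 1\<close> and \<open>r = 0\<close>, so \<open>q\<close> is a unit.
\<close>

lemma hensel_factorization:
  fixes D :: "'a::idom poly fps"
  assumes "D $ 0 = monom 1 d"
  shows "\<exists>W U V. D = W * U \<and> W = D * V \<and> U * V = 1 \<and> x_monic d W"
proof -
  obtain q r where qr: "fps_const (monom 1 d) = q * D + r" "x_deg_less d r"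
    using weierstrass_division[OF assms] by blast
  define W where "W = fps_const (monom 1 d) - r"
  have W: "W = q * D" using qr(1) by (simp add: W_def)
  have "monom 1 d = q $ 0 * monom 1 d + r $ 0"
    using arg_cong[OF qr(1), of "\<lambda>f. f $ 0"] by (simp add: fps_mult_nth_0 assms)
  hence r0: "r $ 0 = monom 1 d * (1 - q $ 0)" by (simp add: algebra_simps)
  have "coeff (1 - q $ 0) j = coeff (r $ 0) (d + j)" for j
    by (simp add: r0 coeff_monom_mult)
  hence "1 - q $ 0 = 0"
    using qr(2) by (intro poly_eqI) (simp add: x_deg_less_def)
  hence q0: "q $ 0 = 1" "r $ 0 = 0" using r0 by auto
  define U where "U = fps_left_inverse q 1"
  have Uq: "U * q = 1" unfolding U_def by (rule fps_left_inverse) (simp add: q0)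
  have "W * U = (U * q) * D" by (simp add: W ac_simps)
  hence "D = W * U" using Uq by simp
  moreover have "x_monic d W"
    unfolding x_monic_def using q0(2) qr(2) by (auto simp: W_def x_deg_less_def)
  ultimately show ?thesis using W Uq by (intro exI[of _ W] exI[of _ U] exI[of _ q]) (simp add: ac_simps)
qed

text \<open>
  In terms of Laurent polynomials, \<open>a = W * f'\<close> where \<open>f'\<close> is \<open>f / x ^ B\<close> with \<open>y / x ^ A\<close> in place of
  \<open>y\<close>. The assumption on \<open>f\<close> says that \<open>f'\<close> has only negative exponents of \<open>x\<close>, and the coefficients of
  \<open>W\<close> have degree at most \<open>d\<close>.
\<close>

lemma x_deg_less_divides:
  fixes p W :: "'a::comm_ring_1 poly fps"
  assumes "x_monic d W"
    and eq: "fps_const (monom 1 B) * tilt A a = tilt A W * f"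
    and f: "\<And>n j. A * n + B \<le> j \<Longrightarrow> coeff (f $ n) j = 0"
  shows "x_deg_less d a"
  unfolding x_deg_less_def
proof (intro allI impI)
  fix n j assume j: "d \<le> j"
  have "coeff (a $ n) j = coeff (monom 1 (A * n + B) * a $ n) (A * n + B + j)"
    by (simp add: coeff_monom_mult)
  also have "monom 1 (A * n + B) * a $ n = (fps_const (monom 1 B) * tilt A a) $ n"
    by (simp add: tilt_def mult_monom add.commute flip: mult.assoc)
  also have "coeff \<dots> (A * n + B + j) =
      (\<Sum>i=0..n. coeff (monom 1 (A * i) * (W $ i * f $ (n - i))) (A * n + B + j))"
    unfolding eq by (simp add: fps_mult_nth coeff_sum tilt_def mult.assoc)
  also have "\<dots> = 0"
  proof (rule sum.neutral, rule ballI)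
    fix i assume i: "i \<in> {0..n}"
    have "A * n = A * i + A * (n - i)" using i by (simp flip: distrib_left)
    hence "coeff (monom 1 (A * i) * (W $ i * f $ (n - i))) (A * n + B + j) =
        coeff (W $ i * f $ (n - i)) (A * (n - i) + B + j)"
      by (simp add: coeff_monom_mult add.assoc)
    also have "\<dots> = 0"
      using j by (intro coeff_mult_eq_0[of d _ "A * (n - i) + B"])
         (auto intro: f x_monic_coeff[OF assms(1)])
    finally show "coeff (monom 1 (A * i) * (W $ i * f $ (n - i))) (A * n + B + j) = 0" .
  qed
  finally show "coeff (a $ n) j = 0" .
qed

text \<open>
  Let \<open>R\<close> be \<open>\<Sum>n. p n * y ^ n\<close> with \<open>y / x ^ A\<close> in place of \<open>y\<close>, divided by \<open>x ^ B\<close>. Then \<open>R = F / D\<close>, and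
  the part of \<open>R\<close> with negative exponents of \<open>x\<close> collects the coefficients of \<open>p n\<close> of index below
  \<open>A * n + B\<close>. Multiplying \<open>R\<close> by \<open>W\<close> gives \<open>F / U\<close>, which is a series with polynomial coefficients because
  \<open>U\<close> is a unit. So \<open>W\<close> times the negative part of \<open>R\<close> also has polynomial coefficients. This product is
  \<open>\<alpha>\<close>, of degree below \<open>d\<close>, and at \<open>x = 1\<close> it gives the last equation.
\<close>

lemma negative_part_decomposition:
  fixes p :: "nat \<Rightarrow> 'a::idom poly" and Q N :: "'a poly poly"
  assumes Q: "coeff Q 0 = 1" and QN: "fps_of_poly Q * Abs_fps p = fps_of_poly N"
  obtains d D F W U V \<alpha> \<beta> s where "x_monic d W" "D = W * U" "U * V = 1" "F = \<alpha> * U + W * \<beta>"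
    "\<forall>n>s. D $ n = 0" "\<forall>n>s. F $ n = 0" "x_deg_less d \<alpha>"
    "eval_at_1 W * Abs_fps (\<lambda>n. \<Sum>j<A * n + B. coeff (p n) j) = eval_at_1 \<alpha>"
proof -
  (* D is x^d Q with y / x^A in place of y, and F is x^(d - B) N with the same substitution. The
     exponent d is large enough for D and F to be free of negative powers of x. *)
  define s where "s = max (degree Q) (degree N)"
  define d where "d = A * s + B"
  define D where "D = Abs_fps (\<lambda>i. if i \<le> s then monom 1 (d - A * i) * coeff Q i else 0)"
  define F where "F = Abs_fps (\<lambda>i. if i \<le> s then monom 1 (d - (A * i + B)) * coeff N i else 0)"
  define P where "P = Abs_fps p"
  define xB where "xB = fps_const (monom (1::'a) B)"
  define xd where "xd = fps_const (monom (1::'a) d)"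
  have le: "A * i + B \<le> d" if "i \<le> s" for i
    using that by (simp add: d_def)
  have zero: "coeff Q i = 0" "coeff N i = 0" if "s < i" for i
    using that by (auto simp: s_def intro: coeff_eq_0)
  have tilt_D: "tilt A D = xd * fps_of_poly Q"
    using le zero by (intro fps_ext)
      (force simp: tilt_def D_def xd_def mult_monom not_le simp flip: mult.assoc)
  have tilt_F: "xB * tilt A F = xd * fps_of_poly N"
    using le zero by (intro fps_ext)
      (force simp: tilt_def F_def xd_def xB_def mult_monom not_le simp flip: mult.assoc)
  have "D $ 0 = monom 1 d" by (simp add: D_def Q)
  from hensel_factorization[OF this] obtain W U V where
    DWU: "D = W * U" and W: "W = D * V" and UV: "U * V = 1" and monic: "x_monic d W"
    by blast
  (* Pm is the negative part of R, tilted and multiplied by x^B; Pp is the part of R with nonnegative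
     exponents. *)
  define Pm where "Pm = Abs_fps (\<lambda>n. poly_cutoff (A * n + B) (p n))"
  define Pp where "Pp = Abs_fps (\<lambda>n. poly_shift (A * n + B) (p n))"
  have P: "P = Pm + xB * tilt A Pp"
  proof (rule fps_ext)
    fix n
    show "P $ n = (Pm + xB * tilt A Pp) $ n"
      using poly_cutoff_plus_shift[of "p n" "A * n + B"]
      by (simp add: P_def Pm_def Pp_def xB_def tilt_def mult_monom add.commute flip: mult.assoc)
  qed
  (* Since W R = F V, this is W times the negative part of R. *)
  define \<alpha> where "\<alpha> = F * V - W * Pp"
  have WPm: "tilt A W * Pm = xB * tilt A \<alpha>"
  proof -
    have "tilt A W * Pm = tilt A W * P - xB * tilt A (W * Pp)"
      by (simp add: P tilt_mult algebra_simps)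
    also have "tilt A W * P = tilt A V * (xd * (fps_of_poly Q * P))"
      by (simp add: W tilt_mult tilt_D ac_simps)
    also have "\<dots> = tilt A V * (xB * tilt A F)"
      using QN by (simp add: tilt_F P_def)
    finally show ?thesis by (simp add: \<alpha>_def tilt_diff tilt_mult algebra_simps)
  qed
  have "\<alpha> * U + W * (U * Pp) = F * (U * V)"
    by (simp add: \<alpha>_def algebra_simps)
  hence F: "F = \<alpha> * U + W * (U * Pp)" using UV by simp
  have \<alpha>_deg: "x_deg_less d \<alpha>"
    using WPm[symmetric] unfolding xB_def
    by (rule x_deg_less_divides[OF monic]) (simp add: Pm_def coeff_poly_cutoff)
  have ev: "eval_at_1 W * Abs_fps (\<lambda>n. \<Sum>j<A * n + B. coeff (p n) j) = eval_at_1 \<alpha>"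
  proof -
    have "eval_at_1 Pm = Abs_fps (\<lambda>n. \<Sum>j<A * n + B. coeff (p n) j)"
    proof (rule fps_ext)
      fix n
      show "eval_at_1 Pm $ n = Abs_fps (\<lambda>n. \<Sum>j<A * n + B. coeff (p n) j) $ n"
        using poly_1_eq_sum_coeffs[of "A * n + B" "poly_cutoff (A * n + B) (p n)"]
        by (simp add: eval_at_1_def Pm_def coeff_poly_cutoff)
    qed
    moreover have "eval_at_1 xB = 1"
      by (rule fps_ext) (simp add: eval_at_1_def xB_def poly_monom)
    ultimately show ?thesis
      using arg_cong[OF WPm, of eval_at_1] by (simp add: eval_at_1_mult eval_at_1_tilt)
  qed
  have "\<forall>n>s. D $ n = 0" "\<forall>n>s. F $ n = 0" by (simp_all add: D_def F_def)
  from that[OF monic DWU UV F this \<alpha>_deg ev] show thesis .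
qed

text \<open>
  The count of \<open>negative_part_decomposition\<close> is \<open>\<alpha> / W\<close> at \<open>x = 1\<close>, so it suffices that \<open>W\<close> and \<open>\<alpha>\<close>, as
  polynomials in \<open>x\<close>, have coefficients algebraic over the rational functions. For \<open>W\<close> this holds since it
  is a monic factor of the polynomial \<open>D\<close>. For \<open>\<alpha>\<close> it holds since \<open>\<alpha>\<close> is the remainder modulo \<open>W\<close> of
  \<open>\<sigma> * F\<close>, where \<open>\<sigma>\<close> is an inverse of \<open>U\<close> modulo \<open>W\<close>.
\<close>

lemma algebraic_over_negative_part:
  fixes p :: "nat \<Rightarrow> 'a::field poly" and Q N :: "'a poly poly"
  assumes Q: "coeff Q 0 = 1" and QN: "fps_of_poly Q * Abs_fps p = fps_of_poly N"
  shows "algebraic_over rational_functions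
    (fps_to_fls (Abs_fps (\<lambda>n. \<Sum>j<A * n + B. coeff (p n) j)))"
proof -
  let ?h = "Abs_fps (\<lambda>n. \<Sum>j<A * n + B. coeff (p n) j)"
  obtain d D F W U V \<alpha> \<beta> s where monic: "x_monic d W" and DWU: "D = W * U"
    and UV: "U * V = 1" and F: "F = \<alpha> * U + W * \<beta>"
    and D_fin: "\<forall>n>s. D $ n = 0" and F_fin: "\<forall>n>s. F $ n = 0"
    and \<alpha>: "x_deg_less d \<alpha>" and h: "eval_at_1 W * ?h = eval_at_1 \<alpha>"
    by (rule negative_part_decomposition[OF Q QN])
  interpret K: field_subset "rational_functions :: 'a fls set"
    by (rule field_subset_rational_functions)
  let ?S = "{x :: 'a fls. algebraic_over rational_functions x}"
  interpret S: field_subset ?S by (rule K.field_subset_algebraic)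

  have "\<exists>e. x_deg_less e D" "\<exists>e. x_deg_less e F"
    using D_fin F_fin by (auto intro: x_deg_less_finite)
  then obtain e1 e2 where D_deg: "x_deg_less e1 D" and F_deg: "x_deg_less e2 F" by blast
  note W_deg = x_deg_less_x_monic[OF monic]
  have cofactor: "\<exists>e. x_deg_less e f" if "x_deg_less e (W * f)" for e f
    using x_deg_less_cofactor[OF monic x_deg_less_mono[OF that, of "d + e"]] by auto
  obtain e3 where U_deg: "x_deg_less e3 U" using cofactor D_deg DWU by blast
  have W\<beta>: "W * \<beta> = F - \<alpha> * U" using F by simp
  have "x_deg_less (max e2 (d + e3)) (W * \<beta>)"
    unfolding W\<beta> by (rule x_deg_less_diff[OF F_deg x_deg_less_mult[OF \<alpha> U_deg]])
  then obtain e4 where \<beta>_deg: "x_deg_less e4 \<beta>"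
    using cofactor by blast

  (* Bezout identity for U and W: reduce the inverse V of U modulo W to a series of bounded degree,
     which becomes a polynomial in x. *)
  have W0: "W $ 0 = monom 1 d" using monic by (simp add: x_monic_def)
  obtain b a where V: "V = b * W + a" and a: "x_deg_less d a"
    using weierstrass_division[OF W0] by blast
  have bU_eq: "W * (b * U) = 1 - a * U"
    using UV by (simp add: V algebra_simps)
  have "x_deg_less (max 1 (d + e3)) (W * (b * U))"
    unfolding bU_eq by (rule x_deg_less_diff[OF x_deg_less_1 x_deg_less_mult[OF a U_deg]])
  then obtain e5 where bU: "x_deg_less e5 (b * U)"
    using cofactor by blast
  have "swap_vars W * swap_vars (b * U) = 1 - swap_vars a * swap_vars U"
    using arg_cong[OF bU_eq, of swap_vars] swap_vars_mult[OF W_deg bU] swap_vars_mult[OF a U_deg]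
      swap_vars_diff[OF x_deg_less_1 x_deg_less_mult[OF a U_deg]] by (simp add: swap_vars_1)
  hence bezout: "swap_vars (b * U) * swap_vars W + swap_vars a * swap_vars U = 1"
    by (simp add: algebra_simps)
  have coprime: "coprime (swap_vars U) (swap_vars W)"
  proof (rule coprimeI)
    fix c assume "c dvd swap_vars U" "c dvd swap_vars W"
    hence "c dvd swap_vars (b * U) * swap_vars W + swap_vars a * swap_vars U" by simp
    thus "is_unit c" by (simp only: bezout)
  qed

  have fin_mem: "swap_vars f \<in> polys_over rational_functions"
    if "\<forall>n>s. f $ n = 0" "x_deg_less e f" for f :: "'a poly fps" and e
  proof -
    have "Abs_fps (\<lambda>n. coeff (f $ n) j) =
        fps_of_poly (Abs_poly (\<lambda>n. coeff (f $ n) j))" for j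
      using that(1) by (intro fps_ext) (simp add: coeff_Abs_poly[of s])
    thus ?thesis
      using fps_of_poly_in_rational_functions
      by (auto simp: polys_over_def coeff_swap_vars[OF that(2)])
  qed
  have K_S: "f \<in> polys_over ?S" if "f \<in> polys_over rational_functions" for f
    using that K.algebraic_over_mem by (auto simp: polys_over_def)
  have D': "swap_vars D = swap_vars W * swap_vars U"
    unfolding DWU by (rule swap_vars_mult[OF W_deg U_deg])
  have W_d: "coeff (swap_vars W) d = 1"
  proof -
    have "Abs_fps (\<lambda>n. coeff (W $ n) d) = 1"
      using monic by (intro fps_ext) (auto simp: x_monic_def)
    thus ?thesis by (simp add: coeff_swap_vars[OF W_deg])
  qed
  have "coeff (swap_vars W) j = 0" if "d < j" for j
    using x_monic_coeff[OF monic that] by (simp add: coeff_swap_vars[OF W_deg] flip: fps_zero_def)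
  hence deg_W: "degree (swap_vars W) = d"
    using W_d by (intro antisym degree_le le_degree) auto
  have W_nz: "swap_vars W \<noteq> 0" using W_d by force
  have "U \<noteq> 0" using UV by auto
  then obtain n j where "coeff (U $ n) j \<noteq> 0" by (auto simp: fps_eq_iff poly_eq_iff)
  hence "coeff (swap_vars U) j \<noteq> 0" by (auto simp: coeff_swap_vars[OF U_deg] fps_eq_iff)
  hence U_nz: "swap_vars U \<noteq> 0" by force
  have W_S: "swap_vars W \<in> polys_over ?S"
  proof (rule K.monic_factor_coeffs_algebraic)
    show "swap_vars W * swap_vars U \<in> polys_over rational_functions"
      using fin_mem[OF D_fin D_deg] by (simp add: D')
  qed (use W_nz U_nz W_d deg_W in auto)
  have "swap_vars D div swap_vars W = swap_vars U" using W_nz by (simp add: D')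
  hence U_S: "swap_vars U \<in> polys_over ?S"
    using S.polys_over_div_mod[OF K_S[OF fin_mem[OF D_fin D_deg]] W_S W_nz] by simp
  obtain \<sigma> \<tau> where \<sigma>: "\<sigma> \<in> polys_over ?S" and \<sigma>\<tau>: "\<sigma> * swap_vars U + \<tau> * swap_vars W = 1"
    using S.bezout_polys_over[OF U_S W_S coprime] by blast
  (* Hence alpha is the remainder of sigma F modulo W. *)
  have F': "swap_vars \<alpha> * swap_vars U = swap_vars F - swap_vars W * swap_vars \<beta>"
    using swap_vars_diff[OF F_deg x_deg_less_mult[OF W_deg \<beta>_deg]] F
    by (simp add: swap_vars_mult[OF W_deg \<beta>_deg] swap_vars_mult[OF \<alpha> U_deg])
  have "swap_vars \<alpha> = \<sigma> * (swap_vars \<alpha> * swap_vars U) + \<tau> * swap_vars \<alpha> * swap_vars W"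
    using arg_cong[OF \<sigma>\<tau>, of "\<lambda>f. swap_vars \<alpha> * f"] by (simp add: algebra_simps)
  also have "\<dots> = \<sigma> * swap_vars F + (\<tau> * swap_vars \<alpha> - \<sigma> * swap_vars \<beta>) * swap_vars W"
    unfolding F' by (simp add: algebra_simps)
  finally have "swap_vars \<alpha> mod swap_vars W =
      (\<sigma> * swap_vars F + (\<tau> * swap_vars \<alpha> - \<sigma> * swap_vars \<beta>) * swap_vars W) mod swap_vars W"
    by (rule arg_cong)
  also have "\<dots> = (\<sigma> * swap_vars F) mod swap_vars W" by (rule mod_mult_self1)
  finally have "swap_vars \<alpha> mod swap_vars W = (\<sigma> * swap_vars F) mod swap_vars W" .
  moreover have "swap_vars \<alpha> mod swap_vars W = swap_vars \<alpha>"
  proof (cases "swap_vars \<alpha> = 0")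
    case False
    have "coeff (swap_vars \<alpha>) j = 0" if "d \<le> j" for j
      using \<alpha> that by (simp add: coeff_swap_vars[OF \<alpha>] x_deg_less_def flip: fps_zero_def)
    moreover have "coeff (swap_vars \<alpha>) (degree (swap_vars \<alpha>)) \<noteq> 0" using False by simp
    ultimately have "degree (swap_vars \<alpha>) < degree (swap_vars W)"
      unfolding deg_W using not_le by blast
    thus ?thesis by (rule mod_poly_less)
  qed simp
  ultimately have mod_eq: "(\<sigma> * swap_vars F) mod swap_vars W = swap_vars \<alpha>" by (simp only:)
  have \<alpha>_S: "swap_vars \<alpha> \<in> polys_over ?S"
    using S.polys_over_div_mod[OF S.polys_over_mult[OF \<sigma> K_S[OF fin_mem[OF F_fin F_deg]]] W_S W_nz]
    unfolding mod_eq by (rule conjunct2)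

  (* W does not vanish at x = 1, since there it is 1 modulo y. *)
  have "poly (swap_vars W) 1 * fps_to_fls ?h = poly (swap_vars \<alpha>) 1"
    using arg_cong[OF h, of fps_to_fls]
    by (simp add: poly_swap_vars_1[OF W_deg] poly_swap_vars_1[OF \<alpha>] fls_times_fps_to_fls)
  moreover have "eval_at_1 W $ 0 = 1" by (simp add: eval_at_1_def W0 poly_monom)
  hence "poly (swap_vars W) 1 \<noteq> 0"
    by (auto simp: poly_swap_vars_1[OF W_deg])
  ultimately have "fps_to_fls ?h = poly (swap_vars \<alpha>) 1 / poly (swap_vars W) 1"
    by (simp add: nonzero_eq_divide_eq mult.commute)
  moreover have "poly (swap_vars \<alpha>) 1 / poly (swap_vars W) 1 \<in> ?S"
    using \<alpha>_S W_S by (intro S.divide_mem S.poly_mem S.one_mem)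
  ultimately show ?thesis by simp
qed

section \<open>Rational generating functions\<close>

text \<open>
  The constant term of the denominator is \<open>1\<close> because the coefficients come from a polynomial ring, where
  few elements are invertible.
\<close>

definition rational_fps :: "'a::comm_ring_1 fps \<Rightarrow> bool" where
  "rational_fps f \<longleftrightarrow> (\<exists>Q N. coeff Q 0 = 1 \<and> fps_of_poly Q * f = fps_of_poly N)"

lemma rational_fpsI: "coeff Q 0 = 1 \<Longrightarrow> fps_of_poly Q * f = fps_of_poly N \<Longrightarrow> rational_fps f"
  by (auto simp: rational_fps_def)

lemma rational_fps_of_poly: "rational_fps (fps_of_poly p)"
  by (rule rational_fpsI[of 1 _ p]) auto

lemma rational_fps_const: "rational_fps (fps_const c)"
  using rational_fps_of_poly[of "[:c:]"] by (simp add: fps_of_poly_const)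

lemma rational_fps_X: "rational_fps fps_X"
  using rational_fps_of_poly[of "[:0, 1:]"] by (simp add: fps_of_poly_fps_X)

lemma rational_fps_add:
  assumes "rational_fps f" "rational_fps g" shows "rational_fps (f + g)"
proof -
  obtain Q N Q' N' where *: "coeff Q 0 = 1" "fps_of_poly Q * f = fps_of_poly N"
    "coeff Q' 0 = 1" "fps_of_poly Q' * g = fps_of_poly N'"
    using assms unfolding rational_fps_def by blast
  have "fps_of_poly (Q * Q') * (f + g) =
      fps_of_poly Q' * (fps_of_poly Q * f) + fps_of_poly Q * (fps_of_poly Q' * g)"
    by (simp add: fps_of_poly_mult algebra_simps)
  also have "\<dots> = fps_of_poly (Q' * N + Q * N')"
    by (simp add: * fps_of_poly_add fps_of_poly_mult)
  finally show ?thesis using * by (intro rational_fpsI) (auto simp: coeff_mult)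
qed

lemma rational_fps_mult:
  assumes "rational_fps f" "rational_fps g" shows "rational_fps (f * g)"
proof -
  obtain Q N Q' N' where *: "coeff Q 0 = 1" "fps_of_poly Q * f = fps_of_poly N"
    "coeff Q' 0 = 1" "fps_of_poly Q' * g = fps_of_poly N'"
    using assms unfolding rational_fps_def by blast
  have "fps_of_poly (Q * Q') * (f * g) = (fps_of_poly Q * f) * (fps_of_poly Q' * g)"
    by (simp add: fps_of_poly_mult algebra_simps)
  also have "\<dots> = fps_of_poly (N * N')"
    by (simp add: * fps_of_poly_mult)
  finally show ?thesis using * by (intro rational_fpsI) (auto simp: coeff_mult)
qed

lemma rational_fps_sum: "(\<And>i. i \<in> A \<Longrightarrow> rational_fps (f i)) \<Longrightarrow> rational_fps (sum f A)"
  using rational_fps_of_poly[of 0]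
  by (induction A rule: infinite_finite_induct) (auto intro: rational_fps_add)

lemma rational_fps_inverse:
  assumes "rational_fps f" "f $ 0 = 1"
  shows "\<exists>g. rational_fps g \<and> g * f = 1"
proof -
  obtain Q N where *: "coeff Q 0 = 1" "fps_of_poly Q * f = fps_of_poly N"
    using assms unfolding rational_fps_def by blast
  define g where "g = fps_left_inverse f 1"
  have gf: "g * f = 1" unfolding g_def by (rule fps_left_inverse) (simp add: assms)
  have "coeff N 0 = (fps_of_poly Q * f) $ 0" by (simp only: *(2) fps_of_poly_nth)
  also have "\<dots> = 1" by (simp add: fps_mult_nth_0 *(1) assms)
  finally have "coeff N 0 = 1" .
  moreover have "fps_of_poly N * g = fps_of_poly Q * (g * f)"
    unfolding *(2)[symmetric] by (simp only: ac_simps)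
  ultimately have "rational_fps g" unfolding gf by (intro rational_fpsI) auto
  with gf show ?thesis by blast
qed

text \<open>
  Gaussian elimination. The pivots \<open>1 - m k k\<close> have constant term \<open>1\<close>, so they are invertible among the
  rational series, and the substitution of the solved unknown keeps the constant terms of the remaining
  matrix zero.
\<close>

lemma rational_fps_linear_system:
  fixes f :: "'i \<Rightarrow> 'a::comm_ring_1 fps"
  assumes "finite I"
    and "\<And>i. i \<in> I \<Longrightarrow> f i = c i + (\<Sum>j\<in>I. m i j * f j)"
    and "\<And>i. i \<in> I \<Longrightarrow> rational_fps (c i)"
    and "\<And>i j. i \<in> I \<Longrightarrow> j \<in> I \<Longrightarrow> rational_fps (m i j) \<and> m i j $ 0 = 0"
    and "i \<in> I"
  shows "rational_fps (f i)"
  using assms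
proof (induction I arbitrary: c m i rule: finite_induct)
  case empty
  thus ?case by simp
next
  case (insert k I)
  have eq: "f i = c i + m i k * f k + (\<Sum>j\<in>I. m i j * f j)" if "i \<in> insert k I" for i
    using insert.prems(1)[OF that] insert.hyps by (simp add: add.assoc)
  have rat: "rational_fps (c i)" "rational_fps (m i j)" "m i j $ 0 = 0"
    if "i \<in> insert k I" "j \<in> insert k I" for i j
    using insert.prems(2)[OF that(1)] insert.prems(3)[OF that] by auto
  have "1 - m k k = 1 + fps_const (- 1) * m k k"
    by (simp add: fps_const_neg[symmetric] del: fps_const_neg)
  also have "rational_fps \<dots>"
    using rational_fps_of_poly[of 1] rat[of k k]
    by (intro rational_fps_add rational_fps_mult rational_fps_const) auto
  finally obtain g where g: "rational_fps g" "g * (1 - m k k) = 1"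
    using rational_fps_inverse[of "1 - m k k"] rat[of k k] by auto
  have fk: "f k = g * c k + (\<Sum>j\<in>I. g * m k j * f j)"
  proof -
    have "f k = g * (1 - m k k) * f k" by (simp add: g)
    also have "\<dots> = g * (f k - m k k * f k)" by (simp add: algebra_simps)
    also have "f k - m k k * f k = c k + (\<Sum>j\<in>I. m k j * f j)"
      using eq[of k] by (simp add: algebra_simps)
    finally show ?thesis by (simp add: algebra_simps sum_distrib_left)
  qed
  (* Substituting f k leaves a system of the same form for the indices in I. *)
  have IH: "rational_fps (f i)" if "i \<in> I" for i
  proof (rule insert.IH[where c = "\<lambda>i. c i + m i k * (g * c k)"
        and m = "\<lambda>i j. m i j + m i k * (g * m k j)"])
    fix i assume i: "i \<in> I"
    have "f i = c i + m i k * (g * c k + (\<Sum>j\<in>I. g * m k j * f j)) + (\<Sum>j\<in>I. m i j * f j)"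
      using eq[of i] i by (simp flip: fk)
    also have "\<dots> = c i + m i k * (g * c k) + (\<Sum>j\<in>I. (m i j + m i k * (g * m k j)) * f j)"
      by (simp add: algebra_simps sum_distrib_left sum.distrib)
    finally show "f i = \<dots>" .
    show "rational_fps (c i + m i k * (g * c k))"
      using i by (intro rational_fps_add rational_fps_mult rat g(1)) auto
    fix j assume "j \<in> I"
    thus "rational_fps (m i j + m i k * (g * m k j)) \<and> (m i j + m i k * (g * m k j)) $ 0 = 0"
      using i rat by (auto simp: fps_mult_nth_0 intro!: rational_fps_add rational_fps_mult g(1))
  qed (use that in auto)
  have "rational_fps (f k)"
    unfolding fk using rat IH
    by (intro rational_fps_add rational_fps_mult rational_fps_sum g(1)) auto
  with IH insert.prems(4) show ?case by auto
qed

section \<open>Boundary states of vertex sets\<close>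

text \<open>
  The invariant of the sequence that the state of a vertex set relies on. That arcs end in vertices makes
  a new vertex isolated.
\<close>

definition well_labelled :: "nat \<Rightarrow> 'v labelled_graph \<Rightarrow> bool" where
  "well_labelled k H \<longleftrightarrow>
     finite (pverts (underlying H)) \<and>
     parcs (underlying H) \<subseteq> pverts (underlying H) \<times> pverts (underlying H) \<and>
     dom (label_of H) \<subseteq> {1..k} \<and>
     ran (label_of H) \<subseteq> pverts (underlying H) \<and>
     (\<forall>i j v. label_of H i = Some v \<longrightarrow> label_of H j = Some v \<longrightarrow> i = j)"

lemma k_labelled_graph_imp_well_labelled: "k_labelled_graph k H \<Longrightarrow> well_labelled k H"
  unfolding k_labelled_graph_def well_labelled_def
  by (auto simp: pair_graph_def pair_digraph_def pair_fin_digraph_def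
       pair_fin_digraph_axioms_def pair_wf_digraph_def inj_on_def dom_def)

lemma Least_fresh: "finite (A :: nat set) \<Longrightarrow> (LEAST v. v \<notin> A) \<notin> A"
  by (rule LeastI_ex) (use ex_new_if_finite infinite_UNIV_nat in blast)

lemma well_labelled_apply_op:
  assumes "well_labelled k H" "valid_op k f"
  shows "well_labelled k (apply_op f H)"
proof (cases f)
  case (Add_Vertex i)
  have "finite (pverts (underlying H))" using assms(1) by (simp add: well_labelled_def)
  note fresh = Least_fresh[OF this]
  show ?thesis
    using assms fresh unfolding Add_Vertex
    by (auto simp: well_labelled_def Let_def ran_def)
next
  case (Change_Label i j)
  thus ?thesis using assms
    by (auto simp: well_labelled_def ran_def split: option.splits if_splits)
next
  case (Remove_Label i)
  thus ?thesis using assms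
    by (auto simp: well_labelled_def ran_def split: if_splits)
next
  case (Add_Edge i j)
  thus ?thesis using assms
    by (auto simp: well_labelled_def ran_def Let_def split: option.splits)
next
  case (Delete_Edge i j)
  thus ?thesis using assms
    by (auto simp: well_labelled_def Let_def split: option.splits)
qed

text \<open>
  What the later operations can still see of a set \<open>S\<close>: the labels that are present, those among them whose
  vertex is in \<open>S\<close>, the arcs between labelled vertices, the labels whose vertex has an unlabelled neighbour
  in \<open>S\<close>, and whether all unlabelled vertices are dominated. Domination by labelled neighbours is not
  recorded as such, since the edge to a labelled neighbour may still be deleted; the edges to unlabelled
  vertices are permanent.
\<close>

type_synonym boundary_state = "nat set \<times> nat set \<times> (nat \<times> nat) set \<times> nat set \<times> bool"

definition boundary_state :: "'v labelled_graph \<Rightarrow> 'v set \<Rightarrow> boundary_state" where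
  "boundary_state H S =
     (dom (label_of H),
      {i. \<exists>v\<in>S. label_of H i = Some v},
      {(i, j). \<exists>u v. label_of H i = Some u \<and> label_of H j = Some v \<and> (u, v) \<in> parcs (underlying H)},
      {i. \<exists>v. label_of H i = Some v \<and> (\<exists>u\<in>S - ran (label_of H). (u, v) \<in> parcs (underlying H))},
      \<forall>v\<in>pverts (underlying H) - ran (label_of H).
        v \<in> S \<or> (\<exists>u\<in>S. (u, v) \<in> parcs (underlying H)))"

definition boundary_states :: "nat \<Rightarrow> boundary_state set" where
  "boundary_states k = Pow {1..k} \<times> Pow {1..k} \<times> Pow ({1..k} \<times> {1..k}) \<times> Pow {1..k} \<times> UNIV"

lemma finite_boundary_states: "finite (boundary_states k)"
  by (simp add: boundary_states_def)

lemma boundary_state_mem: "well_labelled k H \<Longrightarrow> boundary_state H S \<in> boundary_states k"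
  by (auto simp: boundary_states_def boundary_state_def well_labelled_def dom_def)

fun accepting :: "boundary_state \<Rightarrow> bool" where
  "accepting (L, I, E, B, ok) \<longleftrightarrow> ok \<and> (\<forall>i\<in>L. i \<in> I \<or> i \<in> B \<or> (\<exists>j\<in>I. (j, i) \<in> E))"

lemma accepting_boundary_state:
  assumes "well_labelled k H" "S \<subseteq> pverts (underlying H)"
  shows "accepting (boundary_state H S) \<longleftrightarrow> dominating_set (underlying H) S"
proof
  assume dom: "dominating_set (underlying H) S"
  have "i \<in> {i. \<exists>v\<in>S. label_of H i = Some v} \<or>
      (\<exists>v. label_of H i = Some v \<and> (\<exists>u\<in>S - ran (label_of H). (u, v) \<in> parcs (underlying H))) \<or>
      (\<exists>j\<in>{i. \<exists>v\<in>S. label_of H i = Some v}. \<exists>u v. label_of H j = Some u \<and>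
        label_of H i = Some v \<and> (u, v) \<in> parcs (underlying H))" if i: "i \<in> dom (label_of H)" for i
  proof -
    obtain v where v: "label_of H i = Some v" using domD[OF i] by blast
    hence "v \<in> pverts (underlying H)" using assms(1) by (auto simp: well_labelled_def ran_def)
    then consider "v \<in> S" | u where "u \<in> S" "(u, v) \<in> parcs (underlying H)"
      using dom by (auto simp: dominating_set_def)
    thus ?thesis
    proof cases
      case (2 u)
      show ?thesis
      proof (cases "u \<in> ran (label_of H)")
        case True
        then obtain j where "label_of H j = Some u" by (auto simp: ran_def)
        thus ?thesis using 2 v by blast
      qed (use 2 v in blast)
    qed (use v in blast)
  qed
  moreover have "\<forall>v\<in>pverts (underlying H) - ran (label_of H).
      v \<in> S \<or> (\<exists>u\<in>S. (u, v) \<in> parcs (underlying H))"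
    using dom by (auto simp: dominating_set_def)
  ultimately show "accepting (boundary_state H S)"
    unfolding boundary_state_def accepting.simps mem_Collect_eq case_prod_conv by blast
next
  assume acc: "accepting (boundary_state H S)"
  note acc = acc[unfolded boundary_state_def accepting.simps mem_Collect_eq case_prod_conv]
  have "v \<in> S \<or> (\<exists>u\<in>S. (u, v) \<in> parcs (underlying H))" if "v \<in> pverts (underlying H)" for v
  proof (cases "v \<in> ran (label_of H)")
    case True
    then obtain i where i: "label_of H i = Some v" by (auto simp: ran_def)
    hence "i \<in> dom (label_of H)" by (simp add: domI)
    with acc consider "\<exists>v\<in>S. label_of H i = Some v"
      | "\<exists>v. label_of H i = Some v \<and> (\<exists>u\<in>S - ran (label_of H). (u, v) \<in> parcs (underlying H))"
      | j where "\<exists>v\<in>S. label_of H j = Some v"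
         "\<exists>u v. label_of H j = Some u \<and> label_of H i = Some v \<and> (u, v) \<in> parcs (underlying H)"
      by blast
    thus ?thesis by cases (use i in auto)
  next
    case False
    thus ?thesis using acc that by blast
  qed
  thus "dominating_set (underlying H) S" using assms(2) by (auto simp: dominating_set_def)
qed

text \<open>
  The vertex of a removed label joins the unlabelled ones. Its edges become permanent, so its neighbours
  are dominated for good if it is in \<open>S\<close>, and it must itself be dominated at this moment.
\<close>

fun state_remove :: "nat \<Rightarrow> boundary_state \<Rightarrow> boundary_state" where
  "state_remove i (L, I, E, B, ok) =
     (if i \<in> L then
       (L - {i}, I - {i}, {(a, b). (a, b) \<in> E \<and> a \<noteq> i \<and> b \<noteq> i},
        {j. j \<noteq> i \<and> (j \<in> B \<or> i \<in> I \<and> (i, j) \<in> E)},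
        ok \<and> (i \<in> I \<or> i \<in> B \<or> (\<exists>j\<in>I. (j, i) \<in> E)))
      else (L, I, E, B, ok))"

text \<open>
  The new label \<open>j\<close> inherits everything from \<open>i\<close>; the label \<open>j\<close> is absent before.
\<close>

fun state_rename :: "nat \<Rightarrow> nat \<Rightarrow> boundary_state \<Rightarrow> boundary_state" where
  "state_rename i j (L, I, E, B, ok) =
     (let g = (\<lambda>a. if a = j then i else a) in
       ({a. a \<noteq> i \<and> g a \<in> L}, {a. a \<noteq> i \<and> g a \<in> I},
        {(a, b). a \<noteq> i \<and> b \<noteq> i \<and> (g a, g b) \<in> E}, {a. a \<noteq> i \<and> g a \<in> B}, ok))"

fun state_add :: "nat \<Rightarrow> bool \<Rightarrow> boundary_state \<Rightarrow> boundary_state" where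
  "state_add i c (L, I, E, B, ok) = (insert i L, if c then insert i I else I, E, B, ok)"

text \<open>
  The flag tells whether a newly added vertex is put into the set. An operation that takes a label away from
  its previous vertex acts on the state as if that label were removed first.
\<close>

fun state_trans :: "elem_op \<Rightarrow> bool \<Rightarrow> boundary_state \<Rightarrow> boundary_state" where
  "state_trans (Add_Vertex i) c s = state_add i c (state_remove i s)"
| "state_trans (Change_Label i j) c s =
     (if i \<in> fst s \<and> i \<noteq> j then state_rename i j (state_remove j s) else s)"
| "state_trans (Remove_Label i) c s = state_remove i s"
| "state_trans (Add_Edge i j) c (L, I, E, B, ok) =
     (L, I, if i \<in> L \<and> j \<in> L then E \<union> {(i, j), (j, i)} else E, B, ok)"
| "state_trans (Delete_Edge i j) c (L, I, E, B, ok) = (L, I, E - {(i, j), (j, i)}, B, ok)"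

text \<open>
  The substance is in the last two components. The removal of \<open>v\<close> from the labelled vertices adds \<open>v\<close> to the
  possible permanent neighbours, and it adds the domination of \<open>v\<close> to the requirements on unlabelled
  vertices; a neighbour of \<open>v\<close> in \<open>S\<close> is either unlabelled or has a label in the state.
\<close>

lemma boundary_state_remove:
  assumes "well_labelled k H"
  shows "boundary_state (H\<lparr>label_of := (label_of H)(i := None)\<rparr>) S = state_remove i (boundary_state H S)"
proof (cases "label_of H i")
  case None
  hence "(label_of H)(i := None) = label_of H" by auto
  thus ?thesis using None by (simp add: boundary_state_def domIff)
next
  case (Some v)
  define l where "l = label_of H"
  define l' where "l' = l(i := None)"
  define A where "A = parcs (underlying H)"
  define V where "V = pverts (underlying H)"
  have inj: "a = b" if "l a = Some w" "l b = Some w" for a b w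
    using assms that by (auto simp: well_labelled_def l_def)
  have li: "l i = Some v" using Some by (simp add: l_def)
  have l': "l' a = Some w \<longleftrightarrow> a \<noteq> i \<and> l a = Some w" for a w
    by (simp add: l'_def)
  have ran_l: "w \<in> ran l \<longleftrightarrow> (\<exists>a. l a = Some w)" for w by (simp add: ran_def)
  have ran: "w \<in> ran l' \<longleftrightarrow> w \<in> ran l \<and> w \<noteq> v" for w
  proof
    assume "w \<in> ran l'"
    then obtain a where "a \<noteq> i" "l a = Some w" by (auto simp: ran_def l')
    thus "w \<in> ran l \<and> w \<noteq> v" using inj[of a w i] li by (auto simp: ran_l)
  next
    assume w: "w \<in> ran l \<and> w \<noteq> v"
    then obtain a where "l a = Some w" by (auto simp: ran_l)
    hence "l' a = Some w" using w li by (auto simp: l')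
    thus "w \<in> ran l'" by (rule ranI)
  qed
  have v: "v \<in> V" "v \<in> ran l"
    using assms Some by (auto simp: well_labelled_def ran_def l_def V_def)
  have lv: "l a = Some v \<longleftrightarrow> a = i" for a using li inj[of a v i] by auto
  have c1: "dom l' = dom l - {i}" by (simp add: l'_def)
  have c2: "{a. \<exists>w\<in>S. l' a = Some w} = {a. \<exists>w\<in>S. l a = Some w} - {i}"
    by (auto simp: l')
  have c3: "{(a, b). \<exists>u w. l' a = Some u \<and> l' b = Some w \<and> (u, w) \<in> A} =
    {(a, b). (a, b) \<in> {(a, b). \<exists>u w. l a = Some u \<and> l b = Some w \<and> (u, w) \<in> A} \<and> a \<noteq> i \<and> b \<noteq> i}"
    by (auto simp: l')
  have c4: "{a. \<exists>w. l' a = Some w \<and> (\<exists>u\<in>S - ran l'. (u, w) \<in> A)} =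
    {a. a \<noteq> i \<and> (a \<in> {a. \<exists>w. l a = Some w \<and> (\<exists>u\<in>S - ran l. (u, w) \<in> A)} \<or>
       i \<in> {a. \<exists>w\<in>S. l a = Some w} \<and>
       (i, a) \<in> {(a, b). \<exists>u w. l a = Some u \<and> l b = Some w \<and> (u, w) \<in> A})}"
    (is "?L = ?R")
  proof (rule Set.set_eqI)
    fix a
    show "a \<in> ?L \<longleftrightarrow> a \<in> ?R"
      using li by (cases "l a") (auto simp: l' ran)
  qed
  have c5: "(\<forall>w\<in>V - ran l'. w \<in> S \<or> (\<exists>u\<in>S. (u, w) \<in> A)) \<longleftrightarrow>
    (\<forall>w\<in>V - ran l. w \<in> S \<or> (\<exists>u\<in>S. (u, w) \<in> A)) \<and>
    (i \<in> {a. \<exists>w\<in>S. l a = Some w} \<or>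
     i \<in> {a. \<exists>w. l a = Some w \<and> (\<exists>u\<in>S - ran l. (u, w) \<in> A)} \<or>
     (\<exists>j\<in>{a. \<exists>w\<in>S. l a = Some w}.
       (j, i) \<in> {(a, b). \<exists>u w. l a = Some u \<and> l b = Some w \<and> (u, w) \<in> A}))"
  proof -
    have "V - ran l' = insert v (V - ran l)" using v ran by blast
    hence "(\<forall>w\<in>V - ran l'. w \<in> S \<or> (\<exists>u\<in>S. (u, w) \<in> A)) \<longleftrightarrow>
      (\<forall>w\<in>V - ran l. w \<in> S \<or> (\<exists>u\<in>S. (u, w) \<in> A)) \<and> (v \<in> S \<or> (\<exists>u\<in>S. (u, v) \<in> A))"
      by auto
    moreover have "(\<exists>u\<in>S. (u, v) \<in> A) \<longleftrightarrow> (\<exists>u\<in>S - ran l. (u, v) \<in> A) \<or>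
        (\<exists>j. \<exists>w\<in>S. l j = Some w \<and> (w, v) \<in> A)"
      using ran_l by blast
    ultimately show ?thesis using li by auto
  qed
  have "boundary_state (H\<lparr>label_of := (label_of H)(i := None)\<rparr>) S =
    (dom l', {a. \<exists>w\<in>S. l' a = Some w},
     {(a, b). \<exists>u w. l' a = Some u \<and> l' b = Some w \<and> (u, w) \<in> A},
     {a. \<exists>w. l' a = Some w \<and> (\<exists>u\<in>S - ran l'. (u, w) \<in> A)},
     \<forall>w\<in>V - ran l'. w \<in> S \<or> (\<exists>u\<in>S. (u, w) \<in> A))"
    by (simp add: boundary_state_def l'_def l_def A_def V_def)
  also have "\<dots> = state_remove i (boundary_state H S)"
  proof -
    have "i \<in> dom l" using li by (rule domI)
    thus ?thesis
      unfolding boundary_state_def c1 c2 c3 c4 c5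
      by (simp only: state_remove.simps l_def[symmetric] A_def[symmetric] V_def[symmetric] if_True)
  qed
  finally show ?thesis .
qed

lemma boundary_state_rename:
  assumes "label_of H i = Some v" "label_of H j = None" "i \<noteq> j"
  shows "boundary_state (H\<lparr>label_of := (label_of H)(i := None, j := Some v)\<rparr>) S =
    state_rename i j (boundary_state H S)"
proof -
  define l where "l = label_of H"
  define l' where "l' = l(i := None, j := Some v)"
  define g where "g = (\<lambda>a. if a = j then i else a)"
  have l': "l' a = (if a = i then None else l (g a))" for a
    using assms by (auto simp: l'_def g_def l_def)
  have l'_Some: "l' a = Some w \<longleftrightarrow> a \<noteq> i \<and> l (g a) = Some w" for a w
    by (simp add: l')
  have ran: "ran l' = ran l"
  proof (rule Set.set_eqI)
    fix w
    have "(\<exists>a. a \<noteq> i \<and> l (g a) = Some w) \<longleftrightarrow> (\<exists>a. l a = Some w)"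
    proof
      assume "\<exists>a. l a = Some w"
      then obtain a where a: "l a = Some w" by blast
      hence "a \<noteq> j" using assms(2) by (auto simp: l_def)
      show "\<exists>a. a \<noteq> i \<and> l (g a) = Some w"
      proof (cases "a = i")
        case True
        thus ?thesis using a assms(3) by (intro exI[of _ j]) (simp add: g_def)
      next
        case False
        thus ?thesis using a \<open>a \<noteq> j\<close> by (intro exI[of _ a]) (simp add: g_def)
      qed
    qed blast
    thus "w \<in> ran l' \<longleftrightarrow> w \<in> ran l" by (simp add: ran_def l'_Some)
  qed
  have dom: "dom l' = {a. a \<noteq> i \<and> g a \<in> dom l}" by (auto simp: dom_def l')
  show ?thesis
    unfolding boundary_state_def state_rename.simps Let_def
    by (simp add: l_def[symmetric] l'_def[symmetric] g_def[symmetric] ran dom l'_Some)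
       (auto simp: g_def)
qed

lemma boundary_state_add:
  assumes "well_labelled k H" "S \<subseteq> pverts (underlying H)" "label_of H i = None" "v \<notin> pverts (underlying H)"
  shows "boundary_state (H\<lparr>underlying := (underlying H)\<lparr>pverts := insert v (pverts (underlying H))\<rparr>,
      label_of := (label_of H)(i := Some v)\<rparr>) (if c then insert v S else S) =
    state_add i c (boundary_state H S)"
proof -
  define l where "l = label_of H"
  define l' where "l' = l(i := Some v)"
  define A where "A = parcs (underlying H)"
  define V where "V = pverts (underlying H)"
  define S' where "S' = (if c then insert v S else S)"
  have A: "(u, w) \<in> A \<Longrightarrow> u \<noteq> v \<and> w \<noteq> v" for u w
    using assms by (auto simp: well_labelled_def A_def)
  have ran: "ran l' = insert v (ran l)" using assms(3) by (simp add: l'_def l_def ran_map_upd)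
  have v: "v \<notin> ran l" "v \<notin> S" using assms by (auto simp: well_labelled_def l_def)
  have l_v: "l a \<noteq> Some v" for a using v by (auto simp: ran_def)
  have l'_Some: "l' a = Some w \<longleftrightarrow> a = i \<and> w = v \<or> a \<noteq> i \<and> l a = Some w" for a w
    by (auto simp: l'_def)
  have li: "l i = None" using assms(3) by (simp add: l_def)
  have c2: "{a. \<exists>w\<in>S'. l' a = Some w} =
      (if c then insert i {a. \<exists>w\<in>S. l a = Some w} else {a. \<exists>w\<in>S. l a = Some w})"
    using v li by (auto simp: l'_Some S'_def l_v)
  have l'_iff: "l' a = Some w \<longleftrightarrow> l a = Some w" if "w \<noteq> v" for a w
    using that li by (auto simp: l'_def)
  have l'_A: "l' a = Some u \<and> l' b = Some w \<and> (u, w) \<in> A \<longleftrightarrow>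
      l a = Some u \<and> l b = Some w \<and> (u, w) \<in> A" for a b u w
    using A[of u w] l'_iff[of u a] l'_iff[of w b] by blast
  have c3: "{(a, b). \<exists>u w. l' a = Some u \<and> l' b = Some w \<and> (u, w) \<in> A} =
      {(a, b). \<exists>u w. l a = Some u \<and> l b = Some w \<and> (u, w) \<in> A}"
    unfolding l'_A by (rule refl)
  have S'_ran: "S' - ran l' = S - ran l" using v by (auto simp: S'_def ran)
  have "l' a = Some w \<and> (\<exists>u\<in>S - ran l. (u, w) \<in> A) \<longleftrightarrow>
      l a = Some w \<and> (\<exists>u\<in>S - ran l. (u, w) \<in> A)" for a w
    using A l'_iff[of w a] by blast
  hence c4: "{a. \<exists>w. l' a = Some w \<and> (\<exists>u\<in>S' - ran l'. (u, w) \<in> A)} =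
      {a. \<exists>w. l a = Some w \<and> (\<exists>u\<in>S - ran l. (u, w) \<in> A)}"
    unfolding S'_ran by (simp only:)
  have "insert v V - ran l' = V - ran l" using assms(4) by (auto simp: ran V_def)
  moreover have "w \<in> S' \<or> (\<exists>u\<in>S'. (u, w) \<in> A) \<longleftrightarrow> w \<in> S \<or> (\<exists>u\<in>S. (u, w) \<in> A)" if "w \<in> V" for w
    using A assms(4) that by (auto simp: S'_def V_def)
  ultimately have c5: "(\<forall>w\<in>insert v V - ran l'. w \<in> S' \<or> (\<exists>u\<in>S'. (u, w) \<in> A)) \<longleftrightarrow>
      (\<forall>w\<in>V - ran l. w \<in> S \<or> (\<exists>u\<in>S. (u, w) \<in> A))"
    by auto
  have "boundary_state (H\<lparr>underlying := (underlying H)\<lparr>pverts := insert v (pverts (underlying H))\<rparr>,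
      label_of := (label_of H)(i := Some v)\<rparr>) S' =
    (dom l', {a. \<exists>w\<in>S'. l' a = Some w},
     {(a, b). \<exists>u w. l' a = Some u \<and> l' b = Some w \<and> (u, w) \<in> A},
     {a. \<exists>w. l' a = Some w \<and> (\<exists>u\<in>S' - ran l'. (u, w) \<in> A)},
     \<forall>w\<in>insert v V - ran l'. w \<in> S' \<or> (\<exists>u\<in>S'. (u, w) \<in> A))"
    by (simp add: boundary_state_def l'_def l_def A_def V_def)
  also have "\<dots> = state_add i c (boundary_state H S)"
    unfolding c2 c3 c4 c5 by (simp add: boundary_state_def l'_def l_def A_def V_def)
  finally show ?thesis by (simp only: S'_def)
qed

lemma boundary_state_change_edges:
  assumes "well_labelled k H" "label_of H i = Some u" "label_of H j = Some v"
  shows "boundary_state (H\<lparr>underlying := (underlying H)\<lparr>parcs := parcs (underlying H) \<union> {(u, v), (v, u)}\<rparr>\<rparr>) S =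
      state_trans (Add_Edge i j) c (boundary_state H S)"
    and "boundary_state (H\<lparr>underlying := (underlying H)\<lparr>parcs := parcs (underlying H) - {(u, v), (v, u)}\<rparr>\<rparr>) S =
      state_trans (Delete_Edge i j) c (boundary_state H S)"
proof -
  define l where "l = label_of H"
  define A where "A = parcs (underlying H)"
  define V where "V = pverts (underlying H)"
  have inj: "a = b" if "l a = Some w" "l b = Some w" for a b w
    using assms(1) that by (auto simp: well_labelled_def l_def)
  have l: "l i = Some u" "l j = Some v" using assms by (auto simp: l_def)
  hence l_eq: "l a = Some u \<longleftrightarrow> a = i" "l a = Some v \<longleftrightarrow> a = j" for a
    using inj[of a u i] inj[of a v j] by auto
  have uv: "u \<in> ran l" "v \<in> ran l" using l by (auto intro: ranI)
  define A' where "A' = A \<union> {(u, v), (v, u)}"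
  define A'' where "A'' = A - {(u, v), (v, u)}"
  have same: "(x, w) \<in> A' \<longleftrightarrow> (x, w) \<in> A" "(x, w) \<in> A'' \<longleftrightarrow> (x, w) \<in> A"
    if "x \<notin> ran l \<or> w \<notin> ran l" for x w
    using that uv by (auto simp: A'_def A''_def)
  have c4: "{a. \<exists>w. l a = Some w \<and> (\<exists>x\<in>S - ran l. (x, w) \<in> A')} =
      {a. \<exists>w. l a = Some w \<and> (\<exists>x\<in>S - ran l. (x, w) \<in> A)}"
    "{a. \<exists>w. l a = Some w \<and> (\<exists>x\<in>S - ran l. (x, w) \<in> A'')} =
      {a. \<exists>w. l a = Some w \<and> (\<exists>x\<in>S - ran l. (x, w) \<in> A)}"
    by (auto simp: same)
  have c5: "(\<forall>w\<in>V - ran l. w \<in> S \<or> (\<exists>x\<in>S. (x, w) \<in> A')) \<longleftrightarrow>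
      (\<forall>w\<in>V - ran l. w \<in> S \<or> (\<exists>x\<in>S. (x, w) \<in> A))"
    "(\<forall>w\<in>V - ran l. w \<in> S \<or> (\<exists>x\<in>S. (x, w) \<in> A'')) \<longleftrightarrow>
      (\<forall>w\<in>V - ran l. w \<in> S \<or> (\<exists>x\<in>S. (x, w) \<in> A))"
    by (auto simp: same)
  have c3: "{(a, b). \<exists>x w. l a = Some x \<and> l b = Some w \<and> (x, w) \<in> A'} =
      {(a, b). \<exists>x w. l a = Some x \<and> l b = Some w \<and> (x, w) \<in> A} \<union> {(i, j), (j, i)}"
  proof -
    have "(\<exists>x w. l a = Some x \<and> l b = Some w \<and> (x, w) \<in> A') \<longleftrightarrow>
        (\<exists>x w. l a = Some x \<and> l b = Some w \<and> (x, w) \<in> A) \<or> a = i \<and> b = j \<or> a = j \<and> b = i" for a b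
      using l l_eq[of a] l_eq[of b] unfolding A'_def by blast
    thus ?thesis by auto
  qed
  have c3': "{(a, b). \<exists>x w. l a = Some x \<and> l b = Some w \<and> (x, w) \<in> A''} =
      {(a, b). \<exists>x w. l a = Some x \<and> l b = Some w \<and> (x, w) \<in> A} - {(i, j), (j, i)}"
  proof -
    have "(\<exists>x w. l a = Some x \<and> l b = Some w \<and> (x, w) \<in> A'') \<longleftrightarrow>
        (\<exists>x w. l a = Some x \<and> l b = Some w \<and> (x, w) \<in> A) \<and>
        \<not> (a = i \<and> b = j) \<and> \<not> (a = j \<and> b = i)" for a b
      using l l_eq[of a] l_eq[of b] unfolding A''_def by fastforce
    thus ?thesis by auto
  qed
  have dom: "i \<in> dom l" "j \<in> dom l" using l by auto
  have "boundary_state (H\<lparr>underlying := (underlying H)\<lparr>parcs := parcs (underlying H) \<union> {(u, v), (v, u)}\<rparr>\<rparr>) S =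
    (dom l, {a. \<exists>w\<in>S. l a = Some w},
     {(a, b). \<exists>x w. l a = Some x \<and> l b = Some w \<and> (x, w) \<in> A'},
     {a. \<exists>w. l a = Some w \<and> (\<exists>x\<in>S - ran l. (x, w) \<in> A')},
     \<forall>w\<in>V - ran l. w \<in> S \<or> (\<exists>x\<in>S. (x, w) \<in> A'))"
    by (simp add: boundary_state_def l_def A_def V_def A'_def)
  also have "\<dots> = state_trans (Add_Edge i j) c (boundary_state H S)"
    unfolding c3 c4 c5 using dom by (simp add: boundary_state_def l_def A_def V_def)
  finally show "boundary_state (H\<lparr>underlying := (underlying H)\<lparr>parcs := parcs (underlying H) \<union> {(u, v), (v, u)}\<rparr>\<rparr>) S =
      state_trans (Add_Edge i j) c (boundary_state H S)" .
  have "boundary_state (H\<lparr>underlying := (underlying H)\<lparr>parcs := parcs (underlying H) - {(u, v), (v, u)}\<rparr>\<rparr>) S =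
    (dom l, {a. \<exists>w\<in>S. l a = Some w},
     {(a, b). \<exists>x w. l a = Some x \<and> l b = Some w \<and> (x, w) \<in> A''},
     {a. \<exists>w. l a = Some w \<and> (\<exists>x\<in>S - ran l. (x, w) \<in> A'')},
     \<forall>w\<in>V - ran l. w \<in> S \<or> (\<exists>x\<in>S. (x, w) \<in> A''))"
    by (simp add: boundary_state_def l_def A_def V_def A''_def)
  also have "\<dots> = state_trans (Delete_Edge i j) c (boundary_state H S)"
    unfolding c3' c4 c5 using dom by (simp add: boundary_state_def l_def A_def V_def)
  finally show "boundary_state (H\<lparr>underlying := (underlying H)\<lparr>parcs := parcs (underlying H) - {(u, v), (v, u)}\<rparr>\<rparr>) S =
      state_trans (Delete_Edge i j) c (boundary_state H S)" .
qed

section \<open>Transfer matrix for dominating sets\<close>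

text \<open>
  A set of vertices of the old graph extends to the new one in two ways if a vertex is added, and in one way
  otherwise.
\<close>

fun op_choices :: "elem_op \<Rightarrow> bool set" where
  "op_choices (Add_Vertex i) = UNIV"
| "op_choices f = {False}"

fun op_weight :: "nat \<Rightarrow> nat \<Rightarrow> elem_op \<Rightarrow> bool \<Rightarrow> 'a::comm_ring_1 poly" where
  "op_weight b e (Add_Vertex i) c = monom 1 (e + (if c then b else 0))"
| "op_weight b e f c = 1"

text \<open>
  The sets in a given state, each marked by an exponent of \<open>x\<close>. The vertices count into the exponent as well,
  so that a bound \<open>q * card V\<close> with negative \<open>q\<close> can be moved to the left side; \<open>\<delta>\<close> turns a weak inequality
  into a strict one.
\<close>

definition state_gf :: "nat \<Rightarrow> nat \<Rightarrow> nat \<Rightarrow> 'v labelled_graph \<Rightarrow> boundary_state \<Rightarrow> 'a::comm_ring_1 poly" where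
  "state_gf b e \<delta> H s =
     (\<Sum>S\<in>{S \<in> Pow (pverts (underlying H)). boundary_state H S = s}.
       monom 1 (b * card S + e * card (pverts (underlying H)) + \<delta>))"

text \<open>
  The entry of the transfer matrix for the passage from state \<open>s\<close> to state \<open>t\<close>.
\<close>

definition trans_weight :: "nat \<Rightarrow> nat \<Rightarrow> elem_op \<Rightarrow> boundary_state \<Rightarrow> boundary_state \<Rightarrow> 'a::comm_ring_1 poly" where
  "trans_weight b e f t s = (\<Sum>c\<in>op_choices f. if state_trans f c s = t then op_weight b e f c else 0)"

lemma boundary_state_apply_Add_Vertex:
  assumes "well_labelled k H" "i \<in> {1..k}" "S \<subseteq> pverts (underlying H)"
  defines "v \<equiv> (LEAST v. v \<notin> pverts (underlying H))"
  shows "boundary_state (apply_op (Add_Vertex i) H) (if c then insert v S else S) =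
    state_trans (Add_Vertex i) c (boundary_state H S)"
proof -
  define H' where "H' = H\<lparr>label_of := (label_of H)(i := None)\<rparr>"
  have H': "well_labelled k H'"
    using well_labelled_apply_op[OF assms(1), of "Remove_Label i"] assms(2) by (simp add: H'_def)
  have v: "v \<notin> pverts (underlying H)"
    unfolding v_def by (rule Least_fresh) (use assms(1) in \<open>simp add: well_labelled_def\<close>)
  have "apply_op (Add_Vertex i) H =
      H'\<lparr>underlying := (underlying H')\<lparr>pverts := insert v (pverts (underlying H'))\<rparr>,
        label_of := (label_of H')(i := Some v)\<rparr>"
    by (simp add: H'_def Let_def v_def)
  thus ?thesis
    using boundary_state_add[OF H', of S i v c] boundary_state_remove[OF assms(1), of i S] assms(3) v
    by (simp add: H'_def)
qed

lemma boundary_state_apply_op: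
  assumes "well_labelled k H" "valid_op k f" "\<And>i. f \<noteq> Add_Vertex i"
  shows "boundary_state (apply_op f H) S = state_trans f c (boundary_state H S)"
proof (cases f)
  case (Add_Vertex i)
  thus ?thesis using assms(3) by blast
next
  case (Remove_Label i)
  thus ?thesis using boundary_state_remove[OF assms(1)] by simp
next
  case (Add_Edge i j)
  show ?thesis
  proof (cases "\<exists>u v. label_of H i = Some u \<and> label_of H j = Some v")
    case True
    then obtain u v where uv: "label_of H i = Some u" "label_of H j = Some v" by blast
    thus ?thesis
      unfolding Add_Edge boundary_state_change_edges(1)[OF assms(1) uv, symmetric]
      by (simp add: Let_def)
  next
    case False
    hence "label_of H i = None \<or> label_of H j = None" by (cases "label_of H i") auto
    hence "apply_op f H = H" unfolding Add_Edge by (auto split: option.splits)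
    moreover have nd: "\<not> (i \<in> dom (label_of H) \<and> j \<in> dom (label_of H))" using False by (auto simp: domIff)
    have "state_trans f c (boundary_state H S) = boundary_state H S"
      unfolding Add_Edge boundary_state_def state_trans.simps by (simp only: nd if_False)
    ultimately show ?thesis by simp
  qed
next
  case (Delete_Edge i j)
  show ?thesis
  proof (cases "\<exists>u v. label_of H i = Some u \<and> label_of H j = Some v")
    case True
    then obtain u v where uv: "label_of H i = Some u" "label_of H j = Some v" by blast
    thus ?thesis
      unfolding Delete_Edge boundary_state_change_edges(2)[OF assms(1) uv, symmetric]
      by (simp add: Let_def)
  next
    case False
    hence none: "label_of H i = None \<or> label_of H j = None" by (cases "label_of H i") auto
    hence "apply_op f H = H" unfolding Delete_Edge by (auto split: option.splits)
    moreover have "state_trans f c (boundary_state H S) = boundary_state H S"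
      using none unfolding Delete_Edge boundary_state_def state_trans.simps by auto
    ultimately show ?thesis by simp
  qed
next
  case (Change_Label i j)
  show ?thesis
  proof (cases "label_of H i")
    case None
    thus ?thesis by (simp add: Change_Label boundary_state_def domIff)
  next
    case (Some v)
    have i: "i \<in> fst (boundary_state H S)" using Some by (simp add: boundary_state_def domI)
    show ?thesis
    proof (cases "i = j")
      case True
      have "(label_of H)(j := Some v) = label_of H" using Some True by auto
      thus ?thesis using Some True by (simp add: Change_Label)
    next
      case False
      define H' where "H' = H\<lparr>label_of := (label_of H)(j := None)\<rparr>"
      have H': "label_of H' i = Some v" "label_of H' j = None" using Some False by (auto simp: H'_def)
      have "apply_op f H = H'\<lparr>label_of := (label_of H')(i := None, j := Some v)\<rparr>"
        using Some False by (simp add: Change_Label H'_def fun_upd_twist)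
      thus ?thesis
        using boundary_state_rename[OF H' False, of S] boundary_state_remove[OF assms(1), of j S] i False
        by (simp add: Change_Label H'_def)
    qed
  qed
qed

lemma pverts_apply_op:
  "pverts (underlying (apply_op f H)) =
     (case f of Add_Vertex i \<Rightarrow> insert (LEAST v. v \<notin> pverts (underlying H)) (pverts (underlying H))
      | _ \<Rightarrow> pverts (underlying H))"
  by (cases f) (auto simp: Let_def split: option.splits)

text \<open>
  The sets of the new graph are the extensions of the sets of the old one. The new state and the new exponent
  depend only on the old state and the choice made, so the sum can be grouped by old states.
\<close>

lemma state_gf_apply_op:
  assumes "well_labelled k H" "valid_op k f"
  shows "state_gf b e \<delta> (apply_op f H) t =
    (\<Sum>s\<in>boundary_states k. trans_weight b e f t s * (state_gf b e \<delta> H s :: 'a::comm_ring_1 poly))"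
proof -
  let ?V = "pverts (underlying H)"
  let ?w = "\<lambda>S. monom (1::'a) (b * card S + e * card ?V + \<delta>)"
  have fin: "finite ?V" using assms(1) by (simp add: well_labelled_def)
  have "state_gf b e \<delta> (apply_op f H) t = (\<Sum>S\<in>Pow ?V. trans_weight b e f t (boundary_state H S) * ?w S)"
  proof (cases "\<exists>i. f = Add_Vertex i")
    case False
    have V: "pverts (underlying (apply_op f H)) = ?V"
      using False by (subst pverts_apply_op) (auto split: elem_op.split)
    have ch: "op_choices f = {False}" "op_weight b e f c = (1 :: 'a poly)" for c
      using False by (cases f; simp)+
    have "boundary_state (apply_op f H) S = state_trans f False (boundary_state H S)" for S
      using boundary_state_apply_op[OF assms] False by blast
    hence "state_gf b e \<delta> (apply_op f H) t =
        (\<Sum>S\<in>{S \<in> Pow ?V. state_trans f False (boundary_state H S) = t}. ?w S)"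
      by (simp add: state_gf_def V)
    also have "\<dots> = (\<Sum>S\<in>Pow ?V. if state_trans f False (boundary_state H S) = t then ?w S else 0)"
      using fin by (intro sum.inter_filter) simp
    also have "\<dots> = (\<Sum>S\<in>Pow ?V. trans_weight b e f t (boundary_state H S) * ?w S)"
      by (intro sum.cong) (simp_all add: trans_weight_def ch)
    finally show ?thesis .
  next
    case True
    then obtain i where f: "f = Add_Vertex i" by blast
    define v where "v = (LEAST v. v \<notin> ?V)"
    have v: "v \<notin> ?V" unfolding v_def by (rule Least_fresh[OF fin])
    have V: "pverts (underlying (apply_op f H)) = insert v ?V"
      unfolding pverts_apply_op f by (simp add: v_def)
    let ?g = "\<lambda>S. if boundary_state (apply_op f H) S = t
        then monom (1::'a) (b * card S + e * card (insert v ?V) + \<delta>) else 0"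
    have "state_gf b e \<delta> (apply_op f H) t = (\<Sum>S\<in>Pow (insert v ?V). ?g S)"
      unfolding state_gf_def V using fin by (intro sum.inter_filter) simp
    also have "\<dots> = (\<Sum>S\<in>Pow ?V. ?g S) + (\<Sum>S\<in>insert v ` Pow ?V. ?g S)"
      unfolding Pow_insert using fin v by (intro sum.union_disjoint) auto
    also have "(\<Sum>S\<in>insert v ` Pow ?V. ?g S) = (\<Sum>S\<in>Pow ?V. ?g (insert v S))"
    proof -
      have "inj_on (insert v) (Pow ?V)" by (rule inj_on_inverseI[where g = "\<lambda>S. S - {v}"]) (use v in auto)
      thus ?thesis by (simp add: sum.reindex o_def)
    qed
    also have "(\<Sum>S\<in>Pow ?V. ?g S) + (\<Sum>S\<in>Pow ?V. ?g (insert v S)) =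
        (\<Sum>S\<in>Pow ?V. ?g S + ?g (insert v S))"
      by (rule sum.distrib[symmetric])
    also have "\<dots> = (\<Sum>S\<in>Pow ?V. trans_weight b e f t (boundary_state H S) * ?w S)"
    proof (rule sum.cong)
      fix S assume "S \<in> Pow ?V"
      hence S: "S \<subseteq> ?V" "v \<notin> S" "finite S" using v fin by (auto intro: finite_subset)
      have i: "i \<in> {1..k}" using assms(2) by (simp add: f)
      note bs = boundary_state_apply_Add_Vertex[OF assms(1) i S(1), folded v_def f]
      have bsT: "boundary_state (apply_op f H) (insert v S) = state_trans f True (boundary_state H S)"
        using bs[of True] by (simp only: if_True)
      have bsF: "boundary_state (apply_op f H) S = state_trans f False (boundary_state H S)"
        using bs[of False] by (simp only: if_False)
      have tw: "trans_weight b e f t (boundary_state H S) =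
          (if state_trans f True (boundary_state H S) = t then monom (1::'a) (e + b) else 0) +
          (if state_trans f False (boundary_state H S) = t then monom 1 e else 0)"
        unfolding trans_weight_def f by (simp add: UNIV_bool)
      have card: "card (insert v S) = Suc (card S)" "card (insert v ?V) = Suc (card ?V)"
        using S v fin by simp_all
      show "?g S + ?g (insert v S) = trans_weight b e f t (boundary_state H S) * ?w S"
        unfolding bsT bsF tw card by (auto simp: mult_monom algebra_simps)
    qed simp
    finally show ?thesis .
  qed
  also have "\<dots> = (\<Sum>s\<in>boundary_states k. \<Sum>S\<in>{S \<in> Pow ?V. boundary_state H S = s}.
      trans_weight b e f t (boundary_state H S) * ?w S)"
    using fin boundary_state_mem[OF assms(1)]
    by (intro sum.group[symmetric]) (auto simp: finite_boundary_states)
  also have "\<dots> = (\<Sum>s\<in>boundary_states k. trans_weight b e f t s * state_gf b e \<delta> H s)"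
    by (intro sum.cong) (auto simp: state_gf_def sum_distrib_left)
  finally show ?thesis .
qed

lemma state_gf_apply_ops:
  assumes "\<forall>f\<in>set ops. valid_op k f"
  shows "\<exists>M. \<forall>H. well_labelled k H \<longrightarrow> (\<forall>t\<in>boundary_states k.
    state_gf b e \<delta> (fold apply_op ops H) t =
    (\<Sum>s\<in>boundary_states k. M t s * (state_gf b e \<delta> H s :: 'a::comm_ring_1 poly)))"
  using assms
proof (induction ops)
  case Nil
  show ?case
    by (rule exI[of _ "\<lambda>t s. if s = t then 1 else 0"])
       (simp add: if_distrib[of "\<lambda>x. x * _"] finite_boundary_states sum.delta cong: if_cong)
next
  case (Cons f ops)
  then obtain M where M: "\<And>H t. well_labelled k H \<Longrightarrow> t \<in> boundary_states k \<Longrightarrow>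
    state_gf b e \<delta> (fold apply_op ops H) t =
    (\<Sum>s\<in>boundary_states k. M t s * (state_gf b e \<delta> H s :: 'a poly))" by auto
  show ?case
  proof (rule exI[of _ "\<lambda>t r. \<Sum>s\<in>boundary_states k. M t s * trans_weight b e f s r"], intro allI impI ballI)
    fix H :: "nat labelled_graph" and t assume H: "well_labelled k H" and t: "t \<in> boundary_states k"
    have f: "valid_op k f" using Cons.prems by simp
    have "state_gf b e \<delta> (fold apply_op (f # ops) H) t =
        (\<Sum>s\<in>boundary_states k. M t s * (state_gf b e \<delta> (apply_op f H) s :: 'a poly))"
      using M[OF well_labelled_apply_op[OF H f] t] by simp
    also have "\<dots> = (\<Sum>s\<in>boundary_states k. \<Sum>r\<in>boundary_states k.
        M t s * trans_weight b e f s r * state_gf b e \<delta> H r)"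
      by (simp add: state_gf_apply_op[OF H f] sum_distrib_left mult.assoc)
    also have "\<dots> = (\<Sum>r\<in>boundary_states k. (\<Sum>s\<in>boundary_states k. M t s * trans_weight b e f s r) *
        state_gf b e \<delta> H r)"
      by (subst sum.swap) (simp add: sum_distrib_right)
    finally show "state_gf b e \<delta> (fold apply_op (f # ops) H) t = \<dots>" .
  qed
qed

lemma well_labelled_fold:
  "well_labelled k H \<Longrightarrow> \<forall>f\<in>set ops. valid_op k f \<Longrightarrow> well_labelled k (fold apply_op ops H)"
  by (induction ops arbitrary: H) (auto intro: well_labelled_apply_op)

lemma card_pverts_fold:
  assumes "\<forall>f\<in>set ops. valid_op k f"
  shows "\<exists>c. \<forall>H. well_labelled k H \<longrightarrow>
    card (pverts (underlying (fold apply_op ops H))) = card (pverts (underlying H)) + c"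
  using assms
proof (induction ops)
  case (Cons f ops)
  then obtain c where c: "\<And>H. well_labelled k H \<Longrightarrow>
    card (pverts (underlying (fold apply_op ops H))) = card (pverts (underlying H)) + c" by auto
  have "card (pverts (underlying (apply_op f H))) =
      card (pverts (underlying H)) + (case f of Add_Vertex _ \<Rightarrow> 1 | _ \<Rightarrow> 0)"
    if "well_labelled k H" for H
  proof -
    have fin: "finite (pverts (underlying H))" using that by (simp add: well_labelled_def)
    show ?thesis using Least_fresh[OF fin] fin
      by (subst pverts_apply_op) (auto split: elem_op.split)
  qed
  thus ?case
    using c Cons.prems
    by (intro exI[of _ "c + (case f of Add_Vertex _ \<Rightarrow> 1 | _ \<Rightarrow> 0)"])
       (simp add: well_labelled_apply_op)
qed simp

definition dominating_gf :: "nat \<Rightarrow> nat \<Rightarrow> nat \<Rightarrow> 'v pair_pre_digraph \<Rightarrow> 'a::comm_ring_1 poly" where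
  "dominating_gf b e \<delta> G =
     (\<Sum>S\<in>{S. dominating_set G S}. monom 1 (b * card S + e * card (pverts G) + \<delta>))"

lemma finite_dominating_sets: "finite (pverts G) \<Longrightarrow> finite {S. dominating_set G S}"
  by (rule finite_subset[of _ "Pow (pverts G)"]) (auto simp: dominating_set_def)

lemma dominating_gf_eq_sum_state_gf:
  assumes "well_labelled k H"
  shows "dominating_gf b e \<delta> (underlying H) =
    (\<Sum>s\<in>{s \<in> boundary_states k. accepting s}. state_gf b e \<delta> H s)"
proof -
  let ?V = "pverts (underlying H)"
  let ?D = "{S. dominating_set (underlying H) S}"
  have fin: "finite ?V" using assms by (simp add: well_labelled_def)
  have acc: "dominating_set (underlying H) S \<longleftrightarrow> S \<subseteq> ?V \<and> accepting (boundary_state H S)" for S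
    using accepting_boundary_state[OF assms, of S] by (auto simp: dominating_set_def)
  have "dominating_gf b e \<delta> (underlying H) = (\<Sum>s\<in>{s \<in> boundary_states k. accepting s}.
      \<Sum>S\<in>{S \<in> ?D. boundary_state H S = s}. monom 1 (b * card S + e * card ?V + \<delta>))"
    unfolding dominating_gf_def
  proof (intro sum.group[symmetric])
    show "boundary_state H ` ?D \<subseteq> {s \<in> boundary_states k. accepting s}"
      using boundary_state_mem[OF assms] by (auto simp: acc)
  qed (simp_all add: finite_dominating_sets[OF fin] finite_boundary_states)
  also have "\<dots> = (\<Sum>s\<in>{s \<in> boundary_states k. accepting s}. state_gf b e \<delta> H s)"
    unfolding state_gf_def by (intro sum.cong) (auto simp: acc)
  finally show ?thesis .
qed

lemma sum_coeffs_dominating_gf: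
  assumes "finite (pverts G)"
  shows "(\<Sum>j<t. coeff (dominating_gf b e \<delta> G :: 'a::comm_ring_1 poly) j) =
    of_nat (card {S. dominating_set G S \<and> b * card S + e * card (pverts G) + \<delta> < t})"
proof -
  have "(\<Sum>j<t. coeff (dominating_gf b e \<delta> G) j :: 'a) =
      (\<Sum>S\<in>{S. dominating_set G S}. \<Sum>j<t. coeff (monom 1 (b * card S + e * card (pverts G) + \<delta>)) j)"
    by (subst sum.swap) (simp add: dominating_gf_def coeff_sum)
  also have "\<dots> = (\<Sum>S\<in>{S. dominating_set G S}. if b * card S + e * card (pverts G) + \<delta> < t then 1 else 0)"
    by (intro sum.cong) (auto simp: sum.delta')
  also have "\<dots> = (\<Sum>S\<in>{S \<in> {S. dominating_set G S}. b * card S + e * card (pverts G) + \<delta> < t}. 1)"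
    using finite_dominating_sets[OF assms] by (intro sum.inter_filter[symmetric])
  finally show ?thesis by simp
qed

text \<open>
  The matrix of one step of the sequence gives a linear system for the generating functions of the states,
  and the accepting states make up the dominating sets. The threshold is linear in the index because each
  step adds the same number \<open>c\<close> of vertices.
\<close>

lemma algebraic_fps_count:
  fixes H :: "nat \<Rightarrow> nat labelled_graph"
  assumes ops: "\<forall>f\<in>set ops. valid_op k f" and H0: "well_labelled k (H 0)"
    and H: "\<And>n. H (Suc n) = fold apply_op ops (H n)"
  shows "algebraic_fps (Abs_fps (\<lambda>n. of_nat (card {S. dominating_set (underlying (H n)) S \<and>
    b * card S + e * card (pverts (underlying (H n))) + \<delta> < a * card (pverts (underlying (H n))) + 1})))"
proof -
  have wl: "well_labelled k (H n)" for n
    by (induction n) (auto simp: H H0 ops intro: well_labelled_fold)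
  obtain c where c: "\<And>H. well_labelled k H \<Longrightarrow>
    card (pverts (underlying (fold apply_op ops H))) = card (pverts (underlying H)) + c"
    using card_pverts_fold[OF ops] by auto
  have card_V: "card (pverts (underlying (H n))) = c * n + card (pverts (underlying (H 0)))" for n
    by (induction n) (auto simp: H c[OF wl])
  obtain M :: "boundary_state \<Rightarrow> boundary_state \<Rightarrow> rat poly" where
    "\<forall>H. well_labelled k H \<longrightarrow> (\<forall>t\<in>boundary_states k.
      state_gf b e \<delta> (fold apply_op ops H) t = (\<Sum>s\<in>boundary_states k. M t s * state_gf b e \<delta> H s))"
    using state_gf_apply_ops[OF ops, of b e \<delta>] by (elim exE)
  hence M: "state_gf b e \<delta> (fold apply_op ops H) t = (\<Sum>s\<in>boundary_states k. M t s * state_gf b e \<delta> H s)"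
    if "well_labelled k H" "t \<in> boundary_states k" for H t
    using that by simp
  define F where "F = (\<lambda>s. Abs_fps (\<lambda>n. state_gf b e \<delta> (H n) s :: rat poly))"
  have "rational_fps (F t)" if t: "t \<in> boundary_states k" for t
  proof (rule rational_fps_linear_system[OF finite_boundary_states[of k], of F
        "\<lambda>t. fps_const (state_gf b e \<delta> (H 0) t)" "\<lambda>t s. fps_X * fps_const (M t s)"])
    fix t assume t: "t \<in> boundary_states k"
    show "F t = fps_const (state_gf b e \<delta> (H 0) t) +
        (\<Sum>s\<in>boundary_states k. fps_X * fps_const (M t s) * F s)"
    proof (rule fps_ext)
      fix n
      show "F t $ n = (fps_const (state_gf b e \<delta> (H 0) t) +
        (\<Sum>s\<in>boundary_states k. fps_X * fps_const (M t s) * F s)) $ n"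
        by (cases n) (auto simp: F_def fps_sum_nth mult.assoc H M[OF wl t])
    qed
  qed (use t in \<open>auto intro: rational_fps_const rational_fps_mult rational_fps_X\<close>)
  hence "rational_fps (\<Sum>s\<in>{s \<in> boundary_states k. accepting s}. F s)"
    by (intro rational_fps_sum) auto
  also have "(\<Sum>s\<in>{s \<in> boundary_states k. accepting s}. F s) =
      Abs_fps (\<lambda>n. dominating_gf b e \<delta> (underlying (H n)))"
    by (rule fps_ext) (simp add: F_def fps_sum_nth dominating_gf_eq_sum_state_gf[OF wl])
  finally obtain Q N where QN: "coeff Q 0 = 1"
    "fps_of_poly Q * Abs_fps (\<lambda>n. dominating_gf b e \<delta> (underlying (H n)) :: rat poly) = fps_of_poly N"
    unfolding rational_fps_def by blast
  have fin: "finite (pverts (underlying (H n)))" for n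
    using wl by (simp add: well_labelled_def)
  have threshold: "a * card (pverts (underlying (H n))) + 1 =
      a * c * n + (a * card (pverts (underlying (H 0))) + 1)" for n
    unfolding card_V[of n] by (simp add: algebra_simps)
  have "(of_nat (card {S. dominating_set (underlying (H n)) S \<and>
      b * card S + e * card (pverts (underlying (H n))) + \<delta> < a * card (pverts (underlying (H n))) + 1}) :: rat) =
    (\<Sum>j<a * c * n + (a * card (pverts (underlying (H 0))) + 1).
      coeff (dominating_gf b e \<delta> (underlying (H n))) j)" for n
    unfolding sum_coeffs_dominating_gf[OF fin] threshold[of n, symmetric] by (rule refl)
  thus ?thesis
    unfolding algebraic_fps_def by (simp only: algebraic_over_negative_part[OF QN])
qed

section \<open>Isomorphism invariance and size thresholds\<close>

lemma digraph_iso_card_dominating_sets: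
  assumes "digraph_iso (with_proj G) (with_proj G')"
  shows "card {S. dominating_set G S \<and> P (card S) (card (pverts G))} =
    card {S. dominating_set G' S \<and> P (card S) (card (pverts G'))}"
proof -
  obtain f where f: "pre_digraph.digraph_isomorphism (with_proj G) f" "with_proj G' = app_iso f (with_proj G)"
    using assms unfolding digraph_iso_def by blast
  define \<phi> where "\<phi> = iso_verts f"
  have V': "pverts G' = \<phi> ` pverts G"
    using arg_cong[OF f(2), of verts] by (simp add: \<phi>_def)
  have inj: "inj_on \<phi> (pverts G)" and wf: "wf_digraph (with_proj G)"
    using f(1) by (simp_all add: pre_digraph.digraph_isomorphism_def \<phi>_def)
  have tail: "iso_tail f = fst" and head: "iso_head f = snd"
    using arg_cong[OF f(2), of tail] arg_cong[OF f(2), of head] by simp_all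
  have arc: "iso_arcs f x = (\<phi> (fst x), \<phi> (snd x))" if "x \<in> parcs G" for x
    using f(1) that tail head
    by (auto simp: pre_digraph.digraph_isomorphism_def \<phi>_def prod_eq_iff)
  have A': "parcs G' = (\<lambda>x. (\<phi> (fst x), \<phi> (snd x))) ` parcs G"
    using arg_cong[OF f(2), of arcs] arc by (auto simp: image_iff)
  have wf: "u \<in> pverts G" "w \<in> pverts G" if "(u, w) \<in> parcs G" for u w
    using wf that by (auto simp: wf_digraph_wp_iff pair_wf_digraph_def)
  have arc_iff: "(\<phi> u, \<phi> w) \<in> parcs G' \<longleftrightarrow> (u, w) \<in> parcs G" if "u \<in> pverts G" "w \<in> pverts G" for u w
  proof
    assume "(\<phi> u, \<phi> w) \<in> parcs G'"
    then obtain u' w' where *: "(u', w') \<in> parcs G" "\<phi> u = \<phi> u'" "\<phi> w = \<phi> w'"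
      by (auto simp: A')
    hence "u = u'" "w = w'" using inj_onD[OF inj] wf[OF *(1)] that by auto
    thus "(u, w) \<in> parcs G" using *(1) by simp
  next
    assume "(u, w) \<in> parcs G"
    thus "(\<phi> u, \<phi> w) \<in> parcs G'" unfolding A' by (rule rev_image_eqI) simp
  qed
  have dom: "dominating_set G' (\<phi> ` S) \<longleftrightarrow> dominating_set G S" if "S \<subseteq> pverts G" for S
  proof -
    have "\<phi> w \<in> \<phi> ` S \<longleftrightarrow> w \<in> S" if "w \<in> pverts G" for w
      using inj \<open>S \<subseteq> pverts G\<close> that by (auto simp: inj_on_def)
    moreover have "(\<exists>u\<in>\<phi> ` S. (u, \<phi> w) \<in> parcs G') \<longleftrightarrow> (\<exists>u\<in>S. (u, w) \<in> parcs G)"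
      if "w \<in> pverts G" for w
      using arc_iff that \<open>S \<subseteq> pverts G\<close> by blast
    ultimately show ?thesis using that by (auto simp: dominating_set_def V')
  qed
  have card: "card (\<phi> ` S) = card S" if "S \<subseteq> pverts G" for S
    using inj that by (intro card_image) (rule inj_on_subset)
  have "bij_betw ((`) \<phi>) {S. dominating_set G S \<and> P (card S) (card (pverts G))}
    {S. dominating_set G' S \<and> P (card S) (card (pverts G'))}"
  proof (rule bij_betwI')
    fix S T assume "S \<in> {S. dominating_set G S \<and> P (card S) (card (pverts G))}"
      "T \<in> {S. dominating_set G S \<and> P (card S) (card (pverts G))}"
    hence "S \<subseteq> pverts G" "T \<subseteq> pverts G" by (auto simp: dominating_set_def)
    thus "\<phi> ` S = \<phi> ` T \<longleftrightarrow> S = T" by (rule inj_on_image_eq_iff[OF inj])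
  next
    fix S assume "S \<in> {S. dominating_set G S \<and> P (card S) (card (pverts G))}"
    moreover from this have "S \<subseteq> pverts G" by (auto simp: dominating_set_def)
    ultimately show "\<phi> ` S \<in> {S. dominating_set G' S \<and> P (card S) (card (pverts G'))}"
      using card[of "pverts G"] by (simp add: dom card V')
  next
    fix T assume T: "T \<in> {S. dominating_set G' S \<and> P (card S) (card (pverts G'))}"
    hence "T \<subseteq> \<phi> ` pverts G" by (auto simp: dominating_set_def V')
    then obtain S where "S \<subseteq> pverts G" "T = \<phi> ` S" by (rule subset_imageE)
    thus "\<exists>S\<in>{S. dominating_set G S \<and> P (card S) (card (pverts G))}. T = \<phi> ` S"
      using T card[of "pverts G"] by (auto simp: dom card V')
  qed
  thus ?thesis by (rule bij_betw_same_card)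
qed

text \<open>
  The sequences start at \<open>1\<close>, the series above at \<open>0\<close>.
\<close>

lemma gen_fun_eq_shift: "gen_fun a = fps_X * Abs_fps (\<lambda>n. of_nat (a (Suc n)))"
  by (rule fps_ext) (simp add: gen_fun_def Suc_le_eq)

lemma algebraic_fps_diff: "algebraic_fps f \<Longrightarrow> algebraic_fps g \<Longrightarrow> algebraic_fps (f - g)"
  using field_subset.diff_mem[OF field_subset.field_subset_algebraic[OF field_subset_rational_functions],
    of "fps_to_fls f" "fps_to_fls g"]
  unfolding algebraic_fps_def fps_to_fls_minus mem_Collect_eq by blast

lemma algebraic_fps_X_mult:
  assumes "algebraic_fps f"
  shows "algebraic_fps (fps_X * f)"
proof -
  interpret K: field_subset "rational_functions :: rat fls set"
    by (rule field_subset_rational_functions)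
  interpret S: field_subset "{x :: rat fls. algebraic_over rational_functions x}"
    by (rule K.field_subset_algebraic)
  have "algebraic_over rational_functions (fps_to_fls (fps_X :: rat fps))"
    using K.algebraic_over_mem[OF fps_of_poly_in_rational_functions[of "[:0, 1:]"]]
    by (simp only: fps_of_poly_fps_X)
  thus ?thesis
    using S.mult_mem[of "fps_to_fls fps_X" "fps_to_fls f"] assms
    unfolding algebraic_fps_def fls_times_fps_to_fls mem_Collect_eq by blast
qed

text \<open>
  Write \<open>q = c / d\<close>. The positive and negative parts of \<open>c\<close> go to different sides, so that all coefficients
  are natural numbers.
\<close>

lemma rat_threshold:
  fixes q :: rat
  obtains b e a :: nat where
    "\<forall>m n. of_nat m \<le> q * of_nat n \<longleftrightarrow> b * m + e * n < a * n + 1"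
    "\<forall>m n. of_nat m < q * of_nat n \<longleftrightarrow> b * m + e * n + 1 < a * n + 1"
proof -
  obtain c d where "quotient_of q = (c, d)" by (cases "quotient_of q")
  hence q: "q = of_int c / of_int d" and d: "d > 0"
    by (rule quotient_of_div, rule quotient_of_denom_pos)
  have rat: "of_nat m \<le> q * of_nat n \<longleftrightarrow> d * int m \<le> c * int n"
    "of_nat m < q * of_nat n \<longleftrightarrow> d * int m < c * int n" for m n
  proof -
    have "of_nat m \<le> q * of_nat n \<longleftrightarrow> of_int (d * int m) \<le> (of_int (c * int n) :: rat)"
      "of_nat m < q * of_nat n \<longleftrightarrow> of_int (d * int m) < (of_int (c * int n) :: rat)"
      using d by (simp_all add: q pos_le_divide_eq pos_less_divide_eq mult.commute)
    thus "of_nat m \<le> q * of_nat n \<longleftrightarrow> d * int m \<le> c * int n"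
      "of_nat m < q * of_nat n \<longleftrightarrow> d * int m < c * int n"
      by (simp_all only: of_int_le_iff of_int_less_iff)
  qed
  have int: "int (nat d * m + nat (- c) * n) = d * int m + max (- c) 0 * int n"
    "int (nat c * n) = max c 0 * int n" for m n
    using d by (simp_all add: max_def)
  have eq: "c * int n = max c 0 * int n - max (- c) 0 * int n" for n
    by (simp add: max_def)
  have "d * int m \<le> c * int n \<longleftrightarrow> nat d * m + nat (- c) * n \<le> nat c * n"
    "d * int m < c * int n \<longleftrightarrow> nat d * m + nat (- c) * n < nat c * n" for m n
    unfolding of_nat_le_iff[where 'a = int, symmetric] of_nat_less_iff[where 'a = int, symmetric] int eq[of n]
    by (simp_all only: le_diff_eq less_diff_eq)
  thus thesis
    by (intro that[of "nat d" "nat (- c)" "nat c"]) (simp_all add: rat less_Suc_eq_le Suc_le_eq)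
qed

theorem theorem6p4:
  fixes G :: "nat \<Rightarrow> 'v pair_pre_digraph" and q :: rat
  assumes "recursively_constructible G"
  shows "algebraic_fps (gen_fun (\<lambda>n. num_dominating_at_most q (G n))) \<and>
         algebraic_fps (gen_fun (\<lambda>n. num_dominating_at_least q (G n)))"
proof -
  obtain k ops H where ops: "\<forall>f\<in>set ops. valid_op k f"
    and H1: "k_labelled_graph k (H 1)" and H: "\<And>n. n \<ge> 1 \<Longrightarrow> H (Suc n) = fold apply_op ops (H n)"
    and iso: "\<And>n. n \<ge> 1 \<Longrightarrow> digraph_iso (with_proj (underlying (H n))) (with_proj (G n))"
    using assms unfolding recursively_constructible_def by blast
  define U where "U = (\<lambda>n. underlying (H (Suc n)))"
  have alg: "algebraic_fps (Abs_fps (\<lambda>n. of_nat (card {S. dominating_set (U n) S \<and>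
      b * card S + e * card (pverts (U n)) + \<delta> < a * card (pverts (U n)) + 1})))" for b e \<delta> a
    unfolding U_def
    by (rule algebraic_fps_count[OF ops]) (use H1 H k_labelled_graph_imp_well_labelled in auto)
  have "well_labelled k (H (Suc n))" for n
    by (induction n) (use H1 H ops in \<open>auto intro: k_labelled_graph_imp_well_labelled well_labelled_fold\<close>)
  hence fin: "finite (pverts (U n))" for n
    by (simp add: U_def well_labelled_def)
  have transfer: "card {S. dominating_set (G (Suc n)) S \<and> P (card S) (card (pverts (G (Suc n))))} =
      card {S. dominating_set (U n) S \<and> P (card S) (card (pverts (U n)))}" for n P
    unfolding U_def by (rule digraph_iso_card_dominating_sets[symmetric, OF iso]) simp
  have at_most: "algebraic_fps (Abs_fps (\<lambda>n. of_nat (num_dominating_at_most q (G (Suc n)))))" for q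
  proof -
    obtain b e a where q: "\<forall>m n. of_nat m \<le> q * of_nat n \<longleftrightarrow> b * m + e * n < a * n + 1"
      and "\<forall>m n. of_nat m < q * of_nat n \<longleftrightarrow> b * m + e * n + 1 < a * n + 1"
      by (rule rat_threshold[of q])
    (* the weak inequality is the case \<delta> = 0 *)
    have "num_dominating_at_most q (G (Suc n)) = card {S. dominating_set (U n) S \<and>
        b * card S + e * card (pverts (U n)) + 0 < a * card (pverts (U n)) + 1}" for n
      unfolding num_dominating_at_most_def q[rule_format] add_0_right
      by (rule transfer[where P = "\<lambda>m n. b * m + e * n < a * n + 1"])
    thus ?thesis using alg[of b e 0 a] by (simp only:)
  qed
  have less: "algebraic_fps (Abs_fps (\<lambda>n. of_nat (card {S. dominating_set (U n) S \<and>
      rat_of_nat (card S) < q * rat_of_nat (card (pverts (U n)))})))"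
  proof -
    obtain b e a where "\<forall>m n. of_nat m \<le> q * of_nat n \<longleftrightarrow> b * m + e * n < a * n + 1"
      and q: "\<forall>m n. of_nat m < q * of_nat n \<longleftrightarrow> b * m + e * n + 1 < a * n + 1"
      by (rule rat_threshold[of q])
    show ?thesis unfolding q[rule_format] by (rule alg)
  qed
  (* A dominating set has at most as many elements as there are vertices, so the bound with q = 1
     counts all of them. *)
  have "(of_nat (num_dominating_at_least q (G (Suc n))) :: rat) =
     of_nat (num_dominating_at_most 1 (G (Suc n))) - of_nat (card {S. dominating_set (U n) S \<and>
      rat_of_nat (card S) < q * rat_of_nat (card (pverts (U n)))})" for n
  proof -
    let ?D = "{S. dominating_set (U n) S}"
    let ?L = "{S. dominating_set (U n) S \<and> rat_of_nat (card S) < q * rat_of_nat (card (pverts (U n)))}"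
    have D: "finite ?D" using finite_dominating_sets[OF fin] .
    have "card S \<le> card (pverts (U n))" if "dominating_set (U n) S" for S
      using that fin by (intro card_mono) (auto simp: dominating_set_def)
    hence "{S. dominating_set (U n) S \<and> rat_of_nat (card S) \<le> 1 * rat_of_nat (card (pverts (U n)))} = ?D"
      by auto
    moreover have "num_dominating_at_most 1 (G (Suc n)) = card {S. dominating_set (U n) S \<and>
        rat_of_nat (card S) \<le> 1 * rat_of_nat (card (pverts (U n)))}"
      unfolding num_dominating_at_most_def
      by (rule transfer[where P = "\<lambda>m n. rat_of_nat m \<le> 1 * rat_of_nat n"])
    ultimately have "num_dominating_at_most 1 (G (Suc n)) = card ?D" by (simp only:)
    moreover have "num_dominating_at_least q (G (Suc n)) = card (?D - ?L)"
    proof -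
      have "?D - ?L = {S. dominating_set (U n) S \<and> q * rat_of_nat (card (pverts (U n))) \<le> rat_of_nat (card S)}"
        by auto
      moreover have "num_dominating_at_least q (G (Suc n)) = card {S. dominating_set (U n) S \<and>
          q * rat_of_nat (card (pverts (U n))) \<le> rat_of_nat (card S)}"
        unfolding num_dominating_at_least_def
        by (rule transfer[where P = "\<lambda>m n. q * rat_of_nat n \<le> rat_of_nat m"])
      ultimately show ?thesis by (simp only:)
    qed
    moreover have L: "?L \<subseteq> ?D" by auto
    moreover have "card (?D - ?L) = card ?D - card ?L"
      by (rule card_Diff_subset[OF finite_subset[OF L D] L])
    moreover have "card ?L \<le> card ?D" by (rule card_mono[OF D L])
    ultimately show ?thesis by (simp add: of_nat_diff)
  qed
  hence "Abs_fps (\<lambda>n. of_nat (num_dominating_at_least q (G (Suc n))) :: rat) =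
     Abs_fps (\<lambda>n. of_nat (num_dominating_at_most 1 (G (Suc n)))) -
     Abs_fps (\<lambda>n. of_nat (card {S. dominating_set (U n) S \<and>
      rat_of_nat (card S) < q * rat_of_nat (card (pverts (U n)))}))"
    by (intro fps_ext) simp
  hence "algebraic_fps (Abs_fps (\<lambda>n. of_nat (num_dominating_at_least q (G (Suc n)))))"
    using algebraic_fps_diff[OF at_most less] by simp
  thus ?thesis
    unfolding gen_fun_eq_shift using at_most by (intro conjI algebraic_fps_X_mult)
qed

end
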